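(* Let $\Bbbk$ be an algebraically closed field of characteristic $0$, let $A$ be the incidence algebra over $\Bbbk$ of $\mathfrak{S}_n$ with respect to the Bruhat order, and let $v\in\mathfrak{S}_n$ be the longest element of some parabolic subgroup. Then $\mathbf{grade}(L_v)=\mathbf{a}(v)=\ell(v)$.
   Context: $\mathfrak{S}_n$ has simple reflections $\sigma_i=(i,i+1)$ and length function $\ell$; a parabolic subgroup is generated by a subset of the simple reflections. $A$ is the path algebra of the quiver with vertices $\mathfrak{S}_n$ and an arrow $p\to q$ whenever $p$ covers $q$ in the Bruhat order, modulo the relations that all paths with the same endpoints coincide. $L_v$ is the simple module one-dimensional at vertex $v$. Modules are finite-dimensional left modules; $\mathbf{grade}(M)=\min\{i:\mathrm{Ext}^i_A(M,A)\ne0\}$. Lusztig's $\mathbf{a}$-function on $\mathfrak{S}_n$ is the unique function constant on two-sided Kazhdan–Lusztig cells (sets of permutations with equal Robinson–Schensted shape) with $\mathbf{a}(w)=\ell(w)$ for $w$ the longest element of a parabolic subgroup. *)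

theory Defs
  imports Main "HOL-Combinatorics.Combinatorics" "HOL-Library.Function_Algebras"
    "HOL-Library.Extended_Nat" "HOL-Computational_Algebra.Polynomial"
begin

type_synonym perm = "nat \<Rightarrow> nat"

definition Sn :: "nat \<Rightarrow> perm set" where
  "Sn n = {\<sigma>. \<sigma> permutes {..<n}}"

definition sref :: "nat \<Rightarrow> perm" where
  "sref i = transpose i (Suc i)"

definition wprod :: "nat list \<Rightarrow> perm" where
  "wprod ws = foldr (\<lambda>i f. sref i \<circ> f) ws id"

definition blength :: "nat \<Rightarrow> perm \<Rightarrow> nat" where
  "blength n w = (LEAST k. \<exists>ws. length ws = k \<and> set ws \<subseteq> {..<n-1} \<and> wprod ws = w)"

definition parab :: "nat set \<Rightarrow> perm set" where
  "parab J = {wprod ws | ws. set ws \<subseteq> J}"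

definition longest_parabolic :: "nat \<Rightarrow> perm \<Rightarrow> bool" where
  "longest_parabolic n v \<longleftrightarrow>
     (\<exists>J \<subseteq> {..<n-1}. v \<in> parab J \<and> (\<forall>u \<in> parab J. blength n u \<le> blength n v))"

definition bstep :: "nat \<Rightarrow> perm \<Rightarrow> perm \<Rightarrow> bool" where
  "bstep n u w \<longleftrightarrow> u \<in> Sn n \<and> (\<exists>i j. i < j \<and> j < n \<and> w = u \<circ> transpose i j)
                     \<and> blength n u < blength n w"

definition bruhat_le :: "nat \<Rightarrow> perm \<Rightarrow> perm \<Rightarrow> bool" where
  "bruhat_le n u w \<longleftrightarrow> u \<in> Sn n \<and> (bstep n)\<^sup>*\<^sup>* u w"

fun rowins :: "nat \<Rightarrow> nat list list \<Rightarrow> nat list list" where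
  "rowins x [] = [[x]]"
| "rowins x (r # rs) =
     (case filter (\<lambda>y. x < y) r of
        [] \<Rightarrow> (r @ [x]) # rs
      | y # _ \<Rightarrow> map (\<lambda>z. if z = y then x else z) r # rowins y rs)"

definition rs_P :: "nat \<Rightarrow> perm \<Rightarrow> nat list list" where
  "rs_P n w = foldl (\<lambda>T x. rowins x T) [] (map w [0..<n])"

definition rs_shape :: "nat \<Rightarrow> perm \<Rightarrow> nat list" where
  "rs_shape n w = map length (rs_P n w)"

text \<open>Lusztig's a-function: the unique function on S_n constant on two-sided cells
  (equal RS shape) with a(w) = l(w) for longest elements of parabolic subgroups
  (set to 0 outside S_n to make it unique as a HOL function).\<close>
definition a_fun :: "nat \<Rightarrow> perm \<Rightarrow> nat" where
  "a_fun n = (THE a. (\<forall>w. w \<notin> Sn n \<longrightarrow> a w = 0)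
      \<and> (\<forall>u \<in> Sn n. \<forall>w \<in> Sn n. rs_shape n u = rs_shape n w \<longrightarrow> a u = a w)
      \<and> (\<forall>w. longest_parabolic n w \<longrightarrow> a w = blength n w))"

record ('k, 'a) kalg =
  acarrier :: "'a set"
  ascal :: "'k \<Rightarrow> 'a \<Rightarrow> 'a"
  amult :: "'a \<Rightarrow> 'a \<Rightarrow> 'a"

record ('k, 'a, 'm) kamod =
  mcarrier :: "'m set"
  mscal :: "'k \<Rightarrow> 'm \<Rightarrow> 'm"
  mact :: "'a \<Rightarrow> 'm \<Rightarrow> 'm"

definition cargs :: "('k,'a) kalg \<Rightarrow> ('k,'a,'m) kamod \<Rightarrow> nat \<Rightarrow> 'a list \<Rightarrow> 'm \<Rightarrow> bool" where
  "cargs A M i as m \<longleftrightarrow> length as = i \<and> set as \<subseteq> acarrier A \<and> m \<in> mcarrier M"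

text \<open>i-cochains of the (k-relative) bar complex computing Ext_A(M,N):
  k-multilinear maps A^i \<times> M \<rightarrow> N, i.e. Hom_k(A^{\<otimes>i} \<otimes> M, N) = Hom_A(Bar_i(M), N).\<close>
definition cochain :: "('k,'a::ab_group_add) kalg \<Rightarrow> ('k,'a,'m::ab_group_add) kamod
    \<Rightarrow> ('k,'a,'n::ab_group_add) kamod \<Rightarrow> nat \<Rightarrow> ('a list \<Rightarrow> 'm \<Rightarrow> 'n) \<Rightarrow> bool" where
  "cochain A M N i f \<longleftrightarrow>
     (\<forall>as m. cargs A M i as m \<longrightarrow> f as m \<in> mcarrier N)
   \<and> (\<forall>as x y c. cargs A M i as x \<and> y \<in> mcarrier M \<longrightarrow>
        f as (x + y) = f as x + f as y \<and> f as (mscal M c x) = mscal N c (f as x))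
   \<and> (\<forall>as m j x y c. cargs A M i as m \<and> j < i \<and> x \<in> acarrier A \<and> y \<in> acarrier A \<longrightarrow>
        f (as[j := x + y]) m = f (as[j := x]) m + f (as[j := y]) m
      \<and> f (as[j := ascal A c x]) m = mscal N c (f (as[j := x]) m))"

definition dcob :: "('k::field,'a) kalg \<Rightarrow> ('k,'a,'m) kamod \<Rightarrow> ('k,'a,'n::ab_group_add) kamod
    \<Rightarrow> nat \<Rightarrow> ('a list \<Rightarrow> 'm \<Rightarrow> 'n) \<Rightarrow> 'a list \<Rightarrow> 'm \<Rightarrow> 'n" where
  "dcob A M N i f as m =
     mact N (hd as) (f (tl as) m)
   + (\<Sum>j\<in>{1..i}. mscal N ((-1) ^ j)
        (f (take (j - 1) as @ [amult A (as ! (j - 1)) (as ! j)] @ drop (j + 1) as) m))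
   + mscal N ((-1) ^ (i + 1)) (f (butlast as) (mact M (last as) m))"

definition coboundary :: "('k::field,'a::ab_group_add) kalg \<Rightarrow> ('k,'a,'m::ab_group_add) kamod
    \<Rightarrow> ('k,'a,'n::ab_group_add) kamod \<Rightarrow> nat \<Rightarrow> ('a list \<Rightarrow> 'm \<Rightarrow> 'n) \<Rightarrow> bool" where
  "coboundary A M N i f \<longleftrightarrow>
     (case i of
        0 \<Rightarrow> (\<forall>as m. cargs A M 0 as m \<longrightarrow> f as m = 0)
      | Suc i' \<Rightarrow> (\<exists>g. cochain A M N i' g \<and>
                    (\<forall>as m. cargs A M i as m \<longrightarrow> f as m = dcob A M N i' g as m)))"

definition ext_nonzero :: "('k::field,'a::ab_group_add) kalg \<Rightarrow> ('k,'a,'m::ab_group_add) kamod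
    \<Rightarrow> ('k,'a,'n::ab_group_add) kamod \<Rightarrow> nat \<Rightarrow> bool" where
  "ext_nonzero A M N i \<longleftrightarrow>
     (\<exists>f. cochain A M N i f
        \<and> (\<forall>as m. cargs A M (Suc i) as m \<longrightarrow> dcob A M N i f as m = 0)
        \<and> \<not> coboundary A M N i f)"

definition regular :: "('k,'a) kalg \<Rightarrow> ('k,'a,'a) kamod" where
  "regular A = \<lparr>mcarrier = acarrier A, mscal = ascal A, mact = amult A\<rparr>"

definition grade :: "('k::field,'a::ab_group_add) kalg \<Rightarrow> ('k,'a,'m::ab_group_add) kamod \<Rightarrow> enat" where
  "grade A M = (if \<exists>i. ext_nonzero A M (regular A) i
                then enat (LEAST i. ext_nonzero A M (regular A) i) else \<infinity>)"

text \<open>An element f is the linear combination \<Sum> f p q [p \<leadsto> q] of the (unique up to the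
  commutativity relations) path classes from p to q, which exist iff q \<le> p.
  Composition is written like functions: [r \<leadsto> q] \<cdot> [p \<leadsto> r] = [p \<leadsto> q], so left modules
  are representations of the quiver (arrow p \<rightarrow> q acts M_p \<rightarrow> M_q).\<close>
definition incA :: "nat \<Rightarrow> ('k::field, perm \<Rightarrow> perm \<Rightarrow> 'k) kalg" where
  "incA n = \<lparr>acarrier = {f. \<forall>p q. f p q \<noteq> 0 \<longrightarrow> p \<in> Sn n \<and> q \<in> Sn n \<and> bruhat_le n q p},
             ascal = (\<lambda>c f p q. c * f p q),
             amult = (\<lambda>f g p q. \<Sum>r\<in>Sn n. f r q * g p r)\<rparr>"

definition simpleL :: "perm \<Rightarrow> ('k::field, perm \<Rightarrow> perm \<Rightarrow> 'k, 'k) kamod" where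
  "simpleL v = \<lparr>mcarrier = UNIV, mscal = (\<lambda>c x. c * x), mact = (\<lambda>f x. f v v * x)\<rparr>"

end

theory Submission
  imports Defs
begin

text \<open>
  As a left module the incidence algebra is the direct sum over \<open>p\<close> of the representations that
  are constant on \<open>[id, p]\<close>. Right multiplication by a simple reflection \<open>s\<close> satisfies
  the lifting property, so an \<open>s\<close>-stable convex set is filtered by two-element intervals
  \<open>{q, qs}\<close>. If \<open>v\<close> is not the bottom element of any such interval, a constant
  representation on \<open>{q, qs}\<close> has no extensions by \<open>L\<^sub>v\<close> in any degree: it is the
  bottom layer of the injective constant representation on \<open>{x. q \<le> x}\<close>, whose other layers are
  of the same kind. Consequently \<open>Ext\<^sup>i(L\<^sub>v, L\<^sub>q)\<close> is \<open>Ext\<^sup>i\<^sup>-\<^sup>1(L\<^sub>v, L\<^sub>q\<^sub>s)\<close> for \<open>q < qs\<close>.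

  For \<open>v\<close> longest in the parabolic subgroup \<open>W\<close> of \<open>J\<close>, which is \<open>[id, v]\<close>, each
  \<open>[id, p] \<inter> W\<close> is either \<open>{id}\<close> or stable under some \<open>s\<close> in \<open>J\<close>. In the second
  case the summand contributes nothing; in the first it contributes \<open>Ext\<^sup>i(L\<^sub>v, L\<^sub>i\<^sub>d)\<close>,
  which moves up to \<open>Hom(L\<^sub>v, L\<^sub>v)\<close> after exactly \<open>\<ell>(v)\<close> shifts.

  For the a-function: inserting a decreasing block larger than everything before it adds one cell to
  each of the first rows, so \<open>\<Sum>\<^sub>i i \<lambda>\<^sub>i\<close> of the shape counts the inversions of a longest
  parabolic element, and every partition arises as such a shape by prescribing its columns.
\<close>

section \<open>The bar complex\<close>

lemma cochain_0:
  "cochain A M N 0 f \<longleftrightarrow> (\<forall>m\<in>mcarrier M. f [] m \<in> mcarrier N)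
   \<and> (\<forall>x\<in>mcarrier M. \<forall>y\<in>mcarrier M. f [] (x + y) = f [] x + f [] y)
   \<and> (\<forall>x\<in>mcarrier M. \<forall>c. f [] (mscal M c x) = mscal N c (f [] x))"
  unfolding cochain_def cargs_def by auto

text \<open>Fixing the first algebra argument lowers the degree by one, so multilinearity can be
  checked by recursion on the degree. Later inductions on cochains run through this form.\<close>

lemma cochain_Suc:
  "cochain A M N (Suc i) f \<longleftrightarrow> (\<forall>a\<in>acarrier A. cochain A M N i (\<lambda>as. f (a # as)))
   \<and> (\<forall>as m x y c. cargs A M i as m \<and> x \<in> acarrier A \<and> y \<in> acarrier A \<longrightarrow>
        f ((x + y) # as) m = f (x # as) m + f (y # as) m
      \<and> f (ascal A c x # as) m = mscal N c (f (x # as) m))" (is "?L \<longleftrightarrow> ?R1 \<and> ?R2")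
proof
  assume L: ?L
  have args: "cargs A M (Suc i) (a # as) m" if "a \<in> acarrier A" "cargs A M i as m" for a as m
    using that by (auto simp: cargs_def)
  have ?R1
  proof
    fix a assume a: "a \<in> acarrier A"
    show "cochain A M N i (\<lambda>as. f (a # as))"
      unfolding cochain_def
    proof (intro conjI allI impI; (elim conjE)?)
      fix as m assume "cargs A M i as m"
      then show "f (a # as) m \<in> mcarrier N" using L args[OF a] unfolding cochain_def by blast
    next
      fix as x y c assume "cargs A M i as x" "y \<in> mcarrier M"
      then show "f (a # as) (x + y) = f (a # as) x + f (a # as) y"
        using L args[OF a] unfolding cochain_def by blast
    next
      fix as x and y and c assume "cargs A M i as x"
      assume "y \<in> mcarrier M"
      then show "f (a # as) (mscal M c x) = mscal N c (f (a # as) x)"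
        using L args[OF a \<open>cargs A M i as x\<close>] unfolding cochain_def by blast
    next
      fix as m j x y c assume *: "cargs A M i as m" "j < i" "x \<in> acarrier A" "y \<in> acarrier A"
      from L args[OF a *(1)] *(2-) show "f (a # as[j := x + y]) m = f (a # as[j := x]) m + f (a # as[j := y]) m"
        unfolding cochain_def by (metis Suc_less_eq list_update_code(3))
    next
      fix as m j x and y and c assume *: "cargs A M i as m" "j < i" "x \<in> acarrier A" "y \<in> acarrier A"
      from L args[OF a *(1)] *(2-) show "f (a # as[j := ascal A c x]) m = mscal N c (f (a # as[j := x]) m)"
        unfolding cochain_def by (metis Suc_less_eq list_update_code(3))
    qed
  qed
  moreover have ?R2
  proof (intro allI impI)
    fix as m x y c assume *: "cargs A M i as m \<and> x \<in> acarrier A \<and> y \<in> acarrier A"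
    then have "cargs A M (Suc i) (x # as) m" using args by blast
    with L * show "f ((x + y) # as) m = f (x # as) m + f (y # as) m
      \<and> f (ascal A c x # as) m = mscal N c (f (x # as) m)"
      unfolding cochain_def by (metis list_update_code(2) zero_less_Suc)
  qed
  ultimately show "?R1 \<and> ?R2" ..
next
  assume R: "?R1 \<and> ?R2"
  have split: "\<exists>a as'. as = a # as' \<and> a \<in> acarrier A \<and> cargs A M i as' m"
    if "cargs A M (Suc i) as m" for as m
    using that by (cases as) (auto simp: cargs_def)
  show ?L
    unfolding cochain_def
  proof (intro conjI allI impI; (elim conjE)?)
    fix as m assume "cargs A M (Suc i) as m"
    then obtain a as' where "as = a # as'" "a \<in> acarrier A" "cargs A M i as' m" using split by blast
    then show "f as m \<in> mcarrier N" using R unfolding cochain_def by blast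
  next
    fix as x y c assume *: "cargs A M (Suc i) as x" "y \<in> mcarrier M"
    then obtain a as' where "as = a # as'" "a \<in> acarrier A" "cargs A M i as' x" using split by blast
    then show "f as (x + y) = f as x + f as y"
      using R * unfolding cochain_def by blast
  next
    fix as x and y and c assume *: "cargs A M (Suc i) as x" "y \<in> mcarrier M"
    then obtain a as' where "as = a # as'" "a \<in> acarrier A" "cargs A M i as' x" using split by blast
    then show "f as (mscal M c x) = mscal N c (f as x)"
      using R * unfolding cochain_def by blast
  next
    fix as m j x y c
    assume *: "cargs A M (Suc i) as m" "j < Suc i" "x \<in> acarrier A" "y \<in> acarrier A"
    then obtain a as' where "as = a # as'" "a \<in> acarrier A" "cargs A M i as' m" using split by blast
    then show "f (as[j := x + y]) m = f (as[j := x]) m + f (as[j := y]) m"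
      using R * unfolding cochain_def by (cases j) auto
  next
    fix as m j x and y and c
    assume *: "cargs A M (Suc i) as m" "j < Suc i" "x \<in> acarrier A" "y \<in> acarrier A"
    then obtain a as' where "as = a # as'" "a \<in> acarrier A" "cargs A M i as' m" using split by blast
    then show "f (as[j := ascal A c x]) m = mscal N c (f (as[j := x]) m)"
      using R * unfolding cochain_def by (cases j) auto
  qed
qed

text \<open>All terms of the bar differential except the action on the target module. The minus sign
  before the recursive call produces the alternating signs, since freezing the first argument shifts
  every position by one.\<close>

fun bar_tail :: "('k, 'a) kalg \<Rightarrow> ('k, 'a, 'm) kamod \<Rightarrow> ('a list \<Rightarrow> 'm \<Rightarrow> 'n::ab_group_add) \<Rightarrow> 'a list \<Rightarrow> 'm \<Rightarrow> 'n"
where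
  "bar_tail A M f [] m = 0"
| "bar_tail A M f [a] m = - f [] (mact M a m)"
| "bar_tail A M f (a # b # as) m = - f (amult A a b # as) m - bar_tail A M (\<lambda>cs. f (a # cs)) (b # as) m"

text \<open>The summand for \<open>j = 1\<close> multiplies the first two arguments; the remaining
  ones are, up to sign, the summands for the cochain with its first argument frozen.\<close>

lemma dcob_Cons:
  fixes A :: "('k::field, 'a) kalg"
  assumes sgn: "\<And>j x. mscal N ((-1) ^ j) x = (if even j then x else - x)"
  shows "length as = i \<Longrightarrow> dcob A M N i f (a # as) m = mact N a (f as m) + bar_tail A M f (a # as) m"
proof -
  have "(\<Sum>j\<in>{1..length as}. mscal N ((-1) ^ j)
        (f (take (j - 1) (a # as) @ [amult A ((a # as) ! (j - 1)) ((a # as) ! j)] @ drop (j + 1) (a # as)) m))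
      + mscal N ((-1) ^ (length as + 1)) (f (butlast (a # as)) (mact M (last (a # as)) m))
      = bar_tail A M f (a # as) m"
  proof (induction as arbitrary: a f)
    case Nil
    then show ?case using sgn[of 1] by simp
  next
    case (Cons b bs)
    let ?T = "\<lambda>f as j. f (take (j - 1) as @ [amult A (as ! (j - 1)) (as ! j)] @ drop (j + 1) as) m"
    let ?t = "\<lambda>f as j. mscal N ((-1) ^ j) (?T f as j)"
    have "(\<Sum>j\<in>{1..length (b # bs)}. ?t f (a # b # bs) j)
        = ?t f (a # b # bs) 1 + (\<Sum>j\<in>{1..length bs}. ?t f (a # b # bs) (Suc j))"
      by (simp only: length_Cons One_nat_def)
         (subst sum.atLeast_Suc_atMost, simp, subst sum.shift_bounds_cl_Suc_ivl, simp)
    also have "?t f (a # b # bs) 1 = - f (amult A a b # bs) m"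
      by (simp only: sgn) simp
    also have "(\<Sum>j\<in>{1..length bs}. ?t f (a # b # bs) (Suc j))
        = (\<Sum>j\<in>{1..length bs}. - ?t (\<lambda>cs. f (a # cs)) (b # bs) j)"
    proof (rule sum.cong[OF refl])
      fix j assume "j \<in> {1..length bs}"
      then obtain j' where j: "j = Suc j'" by (cases j) auto
      have "?T f (a # b # bs) (Suc j) = ?T (\<lambda>cs. f (a # cs)) (b # bs) j"
        by (simp add: j)
      then show "?t f (a # b # bs) (Suc j) = - ?t (\<lambda>cs. f (a # cs)) (b # bs) j"
        unfolding sgn by simp
    qed
    also have "\<dots> = - (\<Sum>j\<in>{1..length bs}. ?t (\<lambda>cs. f (a # cs)) (b # bs) j)"
      by (rule sum_negf)
    finally have 1: "(\<Sum>j\<in>{1..length (b # bs)}. ?t f (a # b # bs) j)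
        = - f (amult A a b # bs) m - (\<Sum>j\<in>{1..length bs}. ?t (\<lambda>cs. f (a # cs)) (b # bs) j)"
      by simp
    have 2: "mscal N ((-1) ^ (length (b # bs) + 1)) (f (butlast (a # b # bs)) (mact M (last (a # b # bs)) m))
       = - mscal N ((-1) ^ (length bs + 1)) (f (a # butlast (b # bs)) (mact M (last (b # bs)) m))"
      unfolding sgn by simp
    show ?case unfolding 1 2 using Cons[of "\<lambda>cs. f (a # cs)" b] by (simp add: algebra_simps)
  qed
  moreover assume "length as = i"
  ultimately show ?thesis
    unfolding dcob_def by (simp add: add.assoc)
qed

text \<open>As simp rules these would eta-expand function-valued cochains under binders.\<close>

declare plus_fun_apply [simp del] minus_apply [simp del] uminus_apply [simp del] zero_fun_apply [simp del]

lemmas fun_simps = fun_eq_iff plus_fun_apply minus_apply uminus_apply zero_fun_apply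

text \<open>The tail combines values of the cochain only by sums and negation, so it commutes with
  additive maps of values. Two maps at once cover sums, truncations, scalings and pointwise
  agreement.\<close>

lemma bar_tail_additive:
  assumes \<phi>: "Modules.additive \<phi>" and \<psi>: "Modules.additive \<psi>"
    and closed: "\<And>a b. a \<in> acarrier A \<Longrightarrow> b \<in> acarrier A \<Longrightarrow> amult A a b \<in> acarrier A"
  shows "(\<And>as m. length as = i \<Longrightarrow> set as \<subseteq> acarrier A \<Longrightarrow> f as m = \<phi> (g as m) + \<psi> (h as m)) \<Longrightarrow>
     length as = Suc i \<Longrightarrow> set as \<subseteq> acarrier A \<Longrightarrow>
     bar_tail A M f as m = \<phi> (bar_tail A M g as m) + \<psi> (bar_tail A M h as m)"
proof (induction i arbitrary: as f g h)
  case 0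
  then obtain a where as: "as = [a]" by (metis length_0_conv length_Suc_conv)
  show ?case
    using 0(1)[of "[]"] by (simp add: as additive.minus[OF \<phi>] additive.minus[OF \<psi>])
next
  case (Suc i)
  obtain a b bs where as: "as = a # b # bs"
    using Suc.prems(2) by (metis length_Suc_conv)
  have "bar_tail A M (\<lambda>cs. f (a # cs)) (b # bs) m = \<phi> (bar_tail A M (\<lambda>cs. g (a # cs)) (b # bs) m)
      + \<psi> (bar_tail A M (\<lambda>cs. h (a # cs)) (b # bs) m)"
    by (rule Suc.IH) (use Suc.prems as in auto)
  moreover have "f (amult A a b # bs) m = \<phi> (g (amult A a b # bs) m) + \<psi> (h (amult A a b # bs) m)"
    by (rule Suc.prems) (use Suc.prems(2,3) closed as in auto)
  ultimately show ?case
    by (simp add: as additive.minus[OF \<phi>] additive.minus[OF \<psi>] additive.diff[OF \<phi>] additive.diff[OF \<psi>])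
qed

text \<open>The Ext computations are carried out over an arbitrary finite poset with a marked
  element \<open>v\<close>; the parameter \<open>K\<close> fixes the coefficient field.\<close>

locale simple_ext =
  fixes P :: "'x set" and le :: "'x \<Rightarrow> 'x \<Rightarrow> bool" and v :: 'x and K :: "'k::field itself"
  assumes finP: "finite P"
    and le_in: "le x y \<Longrightarrow> x \<in> P \<and> y \<in> P"
    and le_refl: "x \<in> P \<Longrightarrow> le x x"
    and le_trans: "le x y \<Longrightarrow> le y z \<Longrightarrow> le x z"
    and le_antisym: "le x y \<Longrightarrow> le y x \<Longrightarrow> x = y"
    and vP: "v \<in> P"
begin

definition Alg :: "('k, 'x \<Rightarrow> 'x \<Rightarrow> 'k) kalg" where
  "Alg = \<lparr>acarrier = {f. \<forall>p q. f p q \<noteq> 0 \<longrightarrow> p \<in> P \<and> q \<in> P \<and> le q p},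
          ascal = (\<lambda>c f p q. c * f p q),
          amult = (\<lambda>f g p q. \<Sum>r\<in>P. f r q * g p r)\<rparr>"

definition L :: "('k, 'x \<Rightarrow> 'x \<Rightarrow> 'k, 'k) kamod" where
  "L = \<lparr>mcarrier = UNIV, mscal = (\<lambda>c x. c * x), mact = (\<lambda>f x. f v v * x)\<rparr>"

text \<open>For \<open>S\<close> convex in the second coordinate, \<open>N S\<close> is the direct sum over \<open>p\<close> of the
  representations that are constant on \<open>{q. (p, q) \<in> S}\<close> and zero elsewhere.\<close>

definition N :: "('x \<times> 'x) set \<Rightarrow> ('k, 'x \<Rightarrow> 'x \<Rightarrow> 'k, 'x \<Rightarrow> 'x \<Rightarrow> 'k) kamod" where
  "N S = \<lparr>mcarrier = {h. \<forall>p q. h p q \<noteq> 0 \<longrightarrow> (p, q) \<in> S},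
          mscal = (\<lambda>c h p q. c * h p q),
          mact = (\<lambda>a h p q. if (p, q) \<in> S then \<Sum>r\<in>P. a r q * h p r else 0)\<rparr>"

definition scale :: "'k \<Rightarrow> ('x \<Rightarrow> 'x \<Rightarrow> 'k) \<Rightarrow> 'x \<Rightarrow> 'x \<Rightarrow> 'k" where
  "scale c h = (\<lambda>p q. c * h p q)"

definition trunc :: "('x \<times> 'x) set \<Rightarrow> ('x \<Rightarrow> 'x \<Rightarrow> 'k) \<Rightarrow> 'x \<Rightarrow> 'x \<Rightarrow> 'k" where
  "trunc S h = (\<lambda>p q. if (p, q) \<in> S then h p q else 0)"

definition tup :: "nat \<Rightarrow> ('x \<Rightarrow> 'x \<Rightarrow> 'k) list set" where
  "tup i = {as. length as = i \<and> set as \<subseteq> acarrier Alg}"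

abbreviation "A \<equiv> acarrier Alg"
abbreviation "NS S \<equiv> mcarrier (N S)"
abbreviation "act S \<equiv> mact (N S)"
abbreviation mul (infixl "\<odot>" 70) where "mul \<equiv> amult Alg"
abbreviation "coch S \<equiv> cochain Alg L (N S)"
abbreviation "bt \<equiv> bar_tail Alg L :: (_ \<Rightarrow> _ \<Rightarrow> ('x \<Rightarrow> 'x \<Rightarrow> 'k)) \<Rightarrow> _"

text \<open>The bar differential with target \<open>N S\<close>, in recursive form; the proof of
  \<open>vanish_iff\<close> identifies it with \<open>dcob\<close> on tuples of the right
  length.\<close>

definition delta :: "('x \<times> 'x) set \<Rightarrow> (('x \<Rightarrow> 'x \<Rightarrow> 'k) list \<Rightarrow> 'k \<Rightarrow> 'x \<Rightarrow> 'x \<Rightarrow> 'k)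
    \<Rightarrow> ('x \<Rightarrow> 'x \<Rightarrow> 'k) list \<Rightarrow> 'k \<Rightarrow> 'x \<Rightarrow> 'x \<Rightarrow> 'k" where
  "delta S f as m = act S (hd as) (f (tl as) m) + bt f as m"

definition cocyc :: "('x \<times> 'x) set \<Rightarrow> nat \<Rightarrow> (('x \<Rightarrow> 'x \<Rightarrow> 'k) list \<Rightarrow> 'k \<Rightarrow> 'x \<Rightarrow> 'x \<Rightarrow> 'k) \<Rightarrow> bool" where
  "cocyc S i f \<longleftrightarrow> (\<forall>as\<in>tup (Suc i). \<forall>m. delta S f as m = 0)"

definition cob :: "('x \<times> 'x) set \<Rightarrow> nat \<Rightarrow> (('x \<Rightarrow> 'x \<Rightarrow> 'k) list \<Rightarrow> 'k \<Rightarrow> 'x \<Rightarrow> 'x \<Rightarrow> 'k) \<Rightarrow> bool" where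
  "cob S i f \<longleftrightarrow> (case i of 0 \<Rightarrow> \<forall>m. f [] m = 0
     | Suc j \<Rightarrow> \<exists>g. coch S j g \<and> (\<forall>as\<in>tup (Suc j). \<forall>m. f as m = delta S g as m))"

definition vanish :: "('x \<times> 'x) set \<Rightarrow> nat \<Rightarrow> bool" where
  "vanish S i \<longleftrightarrow> \<not> ext_nonzero Alg L (N S) i"

text \<open>Order convexity in each fibre over \<open>p\<close>. It makes the truncated action on
  \<open>N S\<close> compatible with products in the algebra.\<close>

definition convex :: "('x \<times> 'x) set \<Rightarrow> bool" where
  "convex S \<longleftrightarrow> (\<forall>p x y z. (p, x) \<in> S \<and> (p, z) \<in> S \<and> le x y \<and> le y z \<longrightarrow> (p, y) \<in> S)"

section \<open>Arithmetic of the incidence algebra and of the modules \<open>N S\<close>\<close>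

lemma A_D: "a \<in> A \<Longrightarrow> a p q \<noteq> 0 \<Longrightarrow> le q p"
  by (auto simp: Alg_def)

lemma A_I: "(\<And>p q. a p q \<noteq> 0 \<Longrightarrow> le q p) \<Longrightarrow> a \<in> A"
  using le_in by (fastforce simp: Alg_def)

lemma ascal_eq [simp]: "ascal Alg = scale"
  by (simp add: Alg_def scale_def fun_simps)

lemma mscal_N [simp]: "mscal (N S) = scale"
  by (simp add: N_def scale_def fun_simps)

lemma L_simps [simp]: "mcarrier L = UNIV" "mscal L c x = c * x" "mact L a x = a v v * x"
  by (simp_all add: L_def)

lemma mul_apply: "(a \<odot> b) p q = (\<Sum>r\<in>P. a r q * b p r)"
  by (simp add: Alg_def)

lemma act_apply: "act S a h p q = (if (p, q) \<in> S then \<Sum>r\<in>P. a r q * h p r else 0)"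
  by (simp add: N_def)

lemma scale_apply [simp]: "scale c h p q = c * h p q"
  by (simp add: scale_def)

lemma scale_lin [simp]: "scale c (x + y) = scale c x + scale c y" "scale c (x - y) = scale c x - scale c y"
  "scale c (- x) = - scale c x" "scale c 0 = 0"
  by (auto simp: fun_simps algebra_simps)

lemma A_add: "a \<in> A \<Longrightarrow> b \<in> A \<Longrightarrow> a + b \<in> A"
  by (rule A_I) (metis A_D add.right_neutral plus_fun_apply)

lemma A_scale: "a \<in> A \<Longrightarrow> scale c a \<in> A"
  by (rule A_I) (metis A_D mult_zero_right scale_apply)

lemma A_mul:
  assumes "a \<in> A" "b \<in> A" shows "a \<odot> b \<in> A"
proof (rule A_I)
  fix p q assume "(a \<odot> b) p q \<noteq> 0"
  then obtain r where "a r q * b p r \<noteq> 0" unfolding mul_apply by (meson sum.not_neutral_contains_not_neutral)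
  then have "le q r" "le r p" using assms A_D by auto
  then show "le q p" by (rule le_trans)
qed

text \<open>A nonzero term of the product needs \<open>v \<le> r \<le> v\<close>, so antisymmetry
  leaves only \<open>r = v\<close>. This multiplicativity is what makes \<open>L\<close> a
  module.\<close>

lemma mul_v:
  assumes "a \<in> A" "b \<in> A" shows "(a \<odot> b) v v = a v v * b v v"
proof -
  have "(a \<odot> b) v v = (\<Sum>r\<in>P. if r = v then a v v * b v v else 0)"
    unfolding mul_apply
  proof (rule sum.cong[OF refl])
    fix r
    show "a r v * b v r = (if r = v then a v v * b v v else 0)"
      using A_D[OF assms(1), of r v] A_D[OF assms(2), of v r] le_antisym[of r v]
      by (cases "r = v") auto
  qed
  then show ?thesis using finP vP by simp
qed

lemma mul_assoc: "a \<odot> b \<odot> c = a \<odot> (b \<odot> c)"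
proof (intro ext)
  fix p q
  have "(a \<odot> b \<odot> c) p q = (\<Sum>r\<in>P. \<Sum>t\<in>P. a t q * b r t * c p r)"
    by (simp add: mul_apply sum_distrib_right)
  also have "\<dots> = (\<Sum>t\<in>P. \<Sum>r\<in>P. a t q * b r t * c p r)" by (rule sum.swap)
  also have "\<dots> = (a \<odot> (b \<odot> c)) p q"
    by (simp add: mul_apply sum_distrib_left mult.assoc)
  finally show "(a \<odot> b \<odot> c) p q = (a \<odot> (b \<odot> c)) p q" .
qed

lemma mul_lin:
  "(a + b) \<odot> c = a \<odot> c + b \<odot> c" "c \<odot> (a + b) = c \<odot> a + c \<odot> b"
  "scale x a \<odot> c = scale x (a \<odot> c)" "c \<odot> scale x a = scale x (c \<odot> a)"
  by (auto simp: fun_simps mul_apply algebra_simps sum.distrib sum_distrib_left)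

lemma act_in: "act S a h \<in> NS S"
  by (simp add: N_def)

lemma NS_D: "h \<in> NS S \<Longrightarrow> (p, q) \<notin> S \<Longrightarrow> h p q = 0"
  by (auto simp: N_def)

lemma NS_I: "(\<And>p q. (p, q) \<notin> S \<Longrightarrow> h p q = 0) \<Longrightarrow> h \<in> NS S"
  by (auto simp: N_def)

lemma NS_lin [simp]: 
  "h \<in> NS S \<Longrightarrow> h' \<in> NS S \<Longrightarrow> h + h' \<in> NS S" "h \<in> NS S \<Longrightarrow> h' \<in> NS S \<Longrightarrow> h - h' \<in> NS S"
  "h \<in> NS S \<Longrightarrow> - h \<in> NS S" "h \<in> NS S \<Longrightarrow> scale c h \<in> NS S" "0 \<in> NS S"
  by (auto intro!: NS_I simp: NS_D fun_simps)

lemma act_lin: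
  "act S a (h + h') = act S a h + act S a h'" "act S a (h - h') = act S a h - act S a h'"
  "act S a (scale c h) = scale c (act S a h)" 
  "act S (a + b) h = act S a h + act S b h"
  "act S (scale c a) h = scale c (act S a h)"
  "act S a 0 = 0"
  by (auto simp: fun_simps act_apply algebra_simps sum.distrib sum_distrib_left sum_subtractf)

text \<open>After exchanging the sums, the two sides differ only by paths through some
  \<open>t\<close> outside \<open>S\<close>. Such a \<open>t\<close> lies between \<open>q\<close>
  and \<open>r\<close>, both in the fibre over \<open>p\<close>, and convexity excludes it.\<close>

lemma act_mul:
  assumes S: "convex S" and a: "a \<in> A" and b: "b \<in> A" and h: "h \<in> NS S"
  shows "act S (a \<odot> b) h = act S a (act S b h)"
proof (intro ext)
  fix p q
  show "act S (a \<odot> b) h p q = act S a (act S b h) p q"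
  proof (cases "(p, q) \<in> S")
    case True
    have "(\<Sum>r\<in>P. (a \<odot> b) r q * h p r) = (\<Sum>r\<in>P. \<Sum>t\<in>P. a t q * b r t * h p r)"
      by (simp add: mul_apply sum_distrib_right)
    also have "\<dots> = (\<Sum>t\<in>P. \<Sum>r\<in>P. a t q * b r t * h p r)" by (rule sum.swap)
    also have "\<dots> = (\<Sum>t\<in>P. a t q * act S b h p t)"
    proof (rule sum.cong[OF refl])
      fix t
      have "a t q * b r t * h p r = 0" if "(p, t) \<notin> S" for r
      proof (rule ccontr)
        assume "\<not> ?thesis"
        then have "a t q \<noteq> 0" "b r t \<noteq> 0" "h p r \<noteq> 0" by auto
        then have "le q t" "le t r" "(p, r) \<in> S" using A_D[OF a] A_D[OF b] NS_D[OF h] by blast+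
        then show False using True that S unfolding convex_def by blast
      qed
      then show "(\<Sum>r\<in>P. a t q * b r t * h p r) = a t q * act S b h p t"
        by (cases "(p, t) \<in> S") (auto simp: act_apply sum_distrib_left mult.assoc intro!: sum.neutral)
    qed
    finally show ?thesis using True by (simp add: act_apply)
  qed (simp add: act_apply)
qed

section \<open>Cochains with values in \<open>N S\<close> and their differential\<close>

lemma tup_0 [simp]: "as \<in> tup 0 \<longleftrightarrow> as = []"
  by (auto simp: tup_def)

lemma tup_Suc: "as \<in> tup (Suc i) \<longleftrightarrow> (\<exists>a bs. as = a # bs \<and> a \<in> A \<and> bs \<in> tup i)"
  by (cases as) (auto simp: tup_def)

lemma tup_Cons [simp]: "a # as \<in> tup (Suc i) \<longleftrightarrow> a \<in> A \<and> as \<in> tup i"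
  by (auto simp: tup_def)

lemma cargs_iff: "cargs Alg L i as m \<longleftrightarrow> as \<in> tup i"
  by (auto simp: cargs_def tup_def)

lemma coch_0: "coch S 0 f \<longleftrightarrow> (\<forall>m. f [] m \<in> NS S) \<and> (\<forall>x y. f [] (x + y) = f [] x + f [] y)
    \<and> (\<forall>c x. f [] (c * x) = scale c (f [] x))"
  by (auto simp: cochain_0)

lemma coch_Suc: "coch S (Suc i) f \<longleftrightarrow> (\<forall>a\<in>A. coch S i (\<lambda>as. f (a # as)))
   \<and> (\<forall>as\<in>tup i. \<forall>m. \<forall>x\<in>A. \<forall>y\<in>A. f ((x + y) # as) m = f (x # as) m + f (y # as) m)
   \<and> (\<forall>as\<in>tup i. \<forall>m. \<forall>x\<in>A. \<forall>c. f (scale c x # as) m = scale c (f (x # as) m))"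
  unfolding cochain_Suc cargs_iff ascal_eq mscal_N by blast

lemma coch_in: "coch S i f \<Longrightarrow> as \<in> tup i \<Longrightarrow> f as m \<in> NS S"
  unfolding cochain_def cargs_iff by blast

text \<open>Postcomposition with linear maps preserves multilinearity; sums, differences, negation
  and truncation of cochains are all instances.\<close>

lemma coch_lin:
  fixes \<phi> \<psi> :: "('x \<Rightarrow> 'x \<Rightarrow> 'k) \<Rightarrow> 'x \<Rightarrow> 'x \<Rightarrow> 'k"
  assumes "\<And>x y. \<phi> (x + y) = \<phi> x + \<phi> y" "\<And>x y. \<psi> (x + y) = \<psi> x + \<psi> y"
    "\<And>c x. \<phi> (scale c x) = scale c (\<phi> x)" "\<And>c x. \<psi> (scale c x) = scale c (\<psi> x)"
    "\<And>x. x \<in> NS T \<Longrightarrow> \<phi> x \<in> NS S" "\<And>x. x \<in> NS T' \<Longrightarrow> \<psi> x \<in> NS S"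
  shows "coch T i f \<Longrightarrow> coch T' i g \<Longrightarrow> coch S i (\<lambda>as m. \<phi> (f as m) + \<psi> (g as m))"
proof (induction i arbitrary: f g)
  case 0
  then show ?case using assms(5,6)
    by (auto simp: coch_0 assms(1-4) algebra_simps)
next
  case (Suc i)
  then show ?case
    by (auto simp: coch_Suc assms(1-4) algebra_simps)
qed

lemma coch_add: "coch S i f \<Longrightarrow> coch S i g \<Longrightarrow> coch S i (\<lambda>as m. f as m + g as m)"
  by (rule coch_lin[of "\<lambda>x. x" "\<lambda>x. x"]) auto

lemma coch_diff: "coch S i f \<Longrightarrow> coch S i g \<Longrightarrow> coch S i (\<lambda>as m. f as m - g as m)"
  using coch_lin[of "\<lambda>x. x" uminus S S S i f g] by (simp add: fun_simps)

lemma coch_uminus: "coch S i f \<Longrightarrow> coch S i (\<lambda>as m. - f as m)"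
  using coch_lin[of "\<lambda>x. 0" uminus S S S i f f] by (simp add: fun_simps)

lemma coch_mono: "coch S i f \<Longrightarrow> S \<subseteq> T \<Longrightarrow> coch T i f"
  unfolding cochain_def by (auto simp: N_def)

lemma coch_restrict: "coch S i f \<Longrightarrow> (\<And>as m. as \<in> tup i \<Longrightarrow> f as m \<in> NS T) \<Longrightarrow> coch T i f"
  unfolding cochain_def cargs_iff by (auto simp: N_def)

lemma trunc_lin: "trunc S (x + y) = trunc S x + trunc S y" "trunc S (scale c x) = scale c (trunc S x)"
  "trunc S (x - y) = trunc S x - trunc S y"
  by (auto simp: trunc_def fun_simps)

lemma trunc_in: "trunc S x \<in> NS S"
  by (auto simp: trunc_def intro: NS_I)

lemma coch_trunc: "coch S i f \<Longrightarrow> coch T i (\<lambda>as m. trunc T (f as m))"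
  using coch_lin[of "trunc T" "\<lambda>x. 0" S T S i f f] by (simp add: trunc_lin trunc_in fun_simps)

lemma bt_lin:
  assumes "Modules.additive \<phi>" "Modules.additive \<psi>"
    "\<And>as m. as \<in> tup i \<Longrightarrow> f as m = \<phi> (g as m) + \<psi> (h as m)" "as \<in> tup (Suc i)"
  shows "bar_tail Alg L f as m = \<phi> (bar_tail Alg L g as m) + \<psi> (bar_tail Alg L h as m)"
  by (rule bar_tail_additive[OF assms(1,2) A_mul, where i = i]) (use assms(3,4) in \<open>auto simp: tup_def\<close>)

lemma additive_id: "Modules.additive (\<lambda>x :: 'b :: ab_group_add. x)"
  and additive_0: "Modules.additive (\<lambda>x :: 'b :: ab_group_add. 0 :: 'c :: ab_group_add)"
  and additive_uminus: "Modules.additive (uminus :: 'b :: ab_group_add \<Rightarrow> 'b)"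
  and additive_act: "Modules.additive (act S a)"
  and additive_trunc: "Modules.additive (trunc S)"
  and additive_scale: "Modules.additive (scale c)"
  by (unfold_locales; simp add: act_lin trunc_lin fun_simps algebra_simps)+

lemma bt_cong:
  "(\<And>as m. as \<in> tup i \<Longrightarrow> f as m = g as m) \<Longrightarrow> as \<in> tup (Suc i) \<Longrightarrow> bt f as m = bt g as m"
  using bt_lin[OF additive_id additive_0, where f = f and g = g and i = i] by simp

lemma bt_add: "as \<in> tup (Suc i) \<Longrightarrow> bt (\<lambda>as m. f as m + g as m) as m = bt f as m + bt g as m"
  using bt_lin[OF additive_id additive_id, where f = "\<lambda>as m. f as m + g as m" and i = i] by simp

lemma bt_map: "Modules.additive \<phi> \<Longrightarrow> as \<in> tup (Suc i) \<Longrightarrow>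
    bar_tail Alg L (\<lambda>as m. \<phi> (f as m)) as m = \<phi> (bar_tail Alg L f as m)"
  using bt_lin[OF _ additive_0, where f = "\<lambda>as m. \<phi> (f as m)" and g = f and i = i] by simp

lemma coch_bt: "coch S i f \<Longrightarrow> coch S (Suc i) (bt f)"
proof (induction i arbitrary: f)
  case 0
  then show ?case
    by (auto simp: coch_0 coch_Suc algebra_simps)
       (auto simp: fun_simps algebra_simps)
next
  case (Suc i)
  have f: "\<And>a. a \<in> A \<Longrightarrow> coch S i (\<lambda>as. f (a # as))" 
      "\<And>as m x y. as \<in> tup i \<Longrightarrow> x \<in> A \<Longrightarrow> y \<in> A \<Longrightarrow> f ((x + y) # as) m = f (x # as) m + f (y # as) m"
      "\<And>as m x c. as \<in> tup i \<Longrightarrow> x \<in> A \<Longrightarrow> f (scale c x # as) m = scale c (f (x # as) m)"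
    using Suc.prems unfolding coch_Suc by blast+
  have g: "\<And>a b. a \<in> A \<Longrightarrow> b \<in> A \<Longrightarrow> coch S i (\<lambda>as. bt (\<lambda>cs. f (a # cs)) (b # as))"
      "\<And>a as m x y. a \<in> A \<Longrightarrow> as \<in> tup i \<Longrightarrow> x \<in> A \<Longrightarrow> y \<in> A \<Longrightarrow>
        bt (\<lambda>cs. f (a # cs)) ((x + y) # as) m = bt (\<lambda>cs. f (a # cs)) (x # as) m + bt (\<lambda>cs. f (a # cs)) (y # as) m"
      "\<And>a as m x c. a \<in> A \<Longrightarrow> as \<in> tup i \<Longrightarrow> x \<in> A \<Longrightarrow>
        bt (\<lambda>cs. f (a # cs)) (scale c x # as) m = scale c (bt (\<lambda>cs. f (a # cs)) (x # as) m)"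
    using Suc.IH[OF f(1)] unfolding coch_Suc by blast+
  have "coch S (Suc i) (\<lambda>as. bt f (a # as))" if a: "a \<in> A" for a
    unfolding coch_Suc
  proof (intro conjI ballI allI)
    fix b assume b: "b \<in> A"
    have "coch S i (\<lambda>bs m. - f (a \<odot> b # bs) m - bt (\<lambda>cs. f (a # cs)) (b # bs) m)"
      by (rule coch_diff[OF coch_uminus[OF f(1)[OF A_mul[OF a b]]] g(1)[OF a b]])
    moreover have "(\<lambda>bs. bt f (a # b # bs)) = (\<lambda>bs m. - f (a \<odot> b # bs) m - bt (\<lambda>cs. f (a # cs)) (b # bs) m)"
      by (intro ext) simp
    ultimately show "coch S i (\<lambda>bs. bt f (a # b # bs))" by simp
  qed (simp_all add: a f g A_mul mul_lin)
  moreover have "bt f ((x + y) # as) m = bt f (x # as) m + bt f (y # as) m"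
    if as: "as \<in> tup (Suc i)" and x: "x \<in> A" and y: "y \<in> A" for as m x y
  proof -
    obtain b bs where b: "as = b # bs" "b \<in> A" "bs \<in> tup i" using as by (auto simp: tup_Suc)
    have "bt (\<lambda>cs. f ((x + y) # cs)) (b # bs) m
       = bt (\<lambda>cs. f (x # cs)) (b # bs) m + bt (\<lambda>cs. f (y # cs)) (b # bs) m"
      using bt_lin[OF additive_id additive_id, where f = "\<lambda>cs. f ((x + y) # cs)" and i = i] f(2) x y b by simp
    then show ?thesis using b x y by (simp add: f A_mul mul_lin)
  qed
  moreover have "bt f (scale c x # as) m = scale c (bt f (x # as) m)"
    if as: "as \<in> tup (Suc i)" and x: "x \<in> A" for as m x c
  proof -
    obtain b bs where b: "as = b # bs" "b \<in> A" "bs \<in> tup i" using as by (auto simp: tup_Suc)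
    have "bt (\<lambda>cs. f (scale c x # cs)) (b # bs) m = scale c (bt (\<lambda>cs. f (x # cs)) (b # bs) m)"
      using bt_lin[OF additive_scale additive_0, where f = "\<lambda>cs. f (scale c x # cs)" and i = i] f(3) x b by simp
    then show ?thesis using b x by (simp add: f A_mul mul_lin)
  qed
  ultimately show ?case unfolding coch_Suc[of S "Suc i" "bt f"] by blast
qed

lemma coch_delta:
  assumes "coch S i f" shows "coch S (Suc i) (delta S f)"
proof -
  have "coch S (Suc i) (\<lambda>as m. act S (hd as) (f (tl as) m))"
    using coch_lin[of "act S _" "\<lambda>x. 0" S S S i f f] assms
    by (auto simp: coch_Suc act_lin act_in fun_simps)
  then show ?thesis
    using coch_add[OF _ coch_bt[OF assms]] unfolding delta_def by blast
qed

text \<open>Unfolding the inner tail at a frozen first entry \<open>a\<close> gives the tail of the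
  cochain with \<open>a\<close> multiplied into the next entry, which cancels by associativity, and
  a double tail of lower degree. In degree zero the cancellation is multiplicativity of evaluation
  at \<open>v\<close>.\<close>

lemma bt_bt: "coch S i f \<Longrightarrow> as \<in> tup (Suc (Suc i)) \<Longrightarrow> bt (bt f) as m = 0"
proof (induction i arbitrary: f as)
  case 0
  then obtain a b where "as = [a, b]" "a \<in> A" "b \<in> A" by (auto simp: tup_Suc)
  then show ?case by (simp add: mul_v mult.assoc)
next
  case (Suc i)
  then obtain a b c cs where as: "as = a # b # c # cs" "a \<in> A" "b \<in> A" "c \<in> A" "cs \<in> tup i"
    by (auto simp: tup_Suc)
  let ?g = "\<lambda>cs. f (a \<odot> hd cs # tl cs)"
  let ?fa = "\<lambda>cs. f (a # cs)"
  have fa: "coch S i ?fa" using Suc.prems as(2) unfolding coch_Suc by blast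
  have "bt (\<lambda>cs. bt f (a # cs)) (b # c # cs) m = - bt ?g (b # c # cs) m + - bt (bt ?fa) (b # c # cs) m"
  proof (rule bt_lin[OF additive_uminus additive_uminus, of "Suc i"])
    fix ds m assume "ds \<in> tup (Suc i)"
    then show "bt f (a # ds) m = - ?g ds m + - bt ?fa ds m"
      by (auto simp: tup_Suc)
  qed (use as in auto)
  also have "bt (bt ?fa) (b # c # cs) m = 0"
    by (rule Suc.IH[OF fa]) (use as in auto)
  finally have E: "bt (\<lambda>cs. bt f (a # cs)) (b # c # cs) m = - bt ?g (b # c # cs) m + - 0" .
  show ?case
    unfolding as(1) by (subst bar_tail.simps(3), subst E) (simp add: mul_assoc)
qed

text \<open>The terms containing the action cancel because a product acts as the composite, which is
  where convexity enters; the remaining terms are \<open>bt_bt\<close>.\<close>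

lemma delta_delta:
  assumes S: "convex S" and f: "coch S i f" and as: "as \<in> tup (Suc (Suc i))"
  shows "delta S (delta S f) as m = 0"
proof -
  obtain a b bs where as': "as = a # b # bs" "a \<in> A" "b \<in> A" "bs \<in> tup i"
    using as by (auto simp: tup_Suc)
  have "bt (delta S f) as m = bt (\<lambda>cs m. act S (hd cs) (f (tl cs) m)) as m + bt (bt f) as m"
    using bt_add[OF as, of "\<lambda>cs m. act S (hd cs) (f (tl cs) m)" "bt f"] unfolding delta_def[abs_def] by simp
  also have "bt (bt f) as m = 0" by (rule bt_bt[OF f as])
  also have "bt (\<lambda>cs m. act S (hd cs) (f (tl cs) m)) as m = - act S (a \<odot> b) (f bs m) - act S a (bt f (b # bs) m)"
    using bt_map[OF additive_act, of "b # bs" i S a f m] as' by simp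
  also have "act S (a \<odot> b) (f bs m) = act S a (act S b (f bs m))"
    by (rule act_mul[OF S as'(2,3) coch_in[OF f as'(4)]])
  finally show ?thesis by (simp add: delta_def[of S "delta S f"]) (simp add: as' delta_def act_lin)
qed

text \<open>Bridge to the general definition of Ext: from here on only \<open>delta\<close> and
  multilinear maps on \<open>tup i\<close> are needed.\<close>

lemma vanish_iff: "vanish S i \<longleftrightarrow> (\<forall>f. coch S i f \<longrightarrow> cocyc S i f \<longrightarrow> cob S i f)"
proof -
  have sgn: "mscal (N S) ((-1) ^ j) x = (if even j then x else - x)" for j x
    by (simp add: fun_simps)
  have d: "dcob Alg L (N S) i f as m = delta S f as m" if "as \<in> tup (Suc i)" for f as m i
  proof -
    obtain a bs where "as = a # bs" "length bs = i" using \<open>as \<in> tup (Suc i)\<close> by (cases as) (auto simp: tup_def)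
    then show ?thesis using dcob_Cons[of "N S", OF sgn, of bs i Alg L f a m] by (simp add: delta_def)
  qed
  show ?thesis
    unfolding vanish_def ext_nonzero_def coboundary_def cob_def cocyc_def cargs_iff
    using d by (cases i) (auto; metis)+
qed

declare scale_apply [simp del]

subsection \<open>Long exact sequences\<close>


text \<open>A down-set inside each fibre. Since the algebra moves vectors downwards,
  \<open>N S'\<close> is then a submodule of \<open>N S\<close>, with quotient
  \<open>N (S - S')\<close>.\<close>

definition lower :: "('x \<times> 'x) set \<Rightarrow> ('x \<times> 'x) set \<Rightarrow> bool" where
  "lower S' S \<longleftrightarrow> S' \<subseteq> S \<and> (\<forall>p x y. (p, y) \<in> S' \<and> (p, x) \<in> S \<and> le x y \<longrightarrow> (p, x) \<in> S')"

lemma act_lower: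
  assumes "lower S' S" "a \<in> A" "h \<in> NS S'" shows "act S a h = act S' a h"
proof (intro ext)
  fix p q
  have "a r q * h p r = 0" if "(p, q) \<in> S" "(p, q) \<notin> S'" for r
    using assms(1) A_D[OF assms(2)] NS_D[OF assms(3), of p r] that unfolding lower_def by fastforce
  moreover have "S' \<subseteq> S" using assms(1) unfolding lower_def by blast
  ultimately show "act S a h p q = act S' a h p q"
    unfolding act_apply by (auto intro!: sum.neutral)
qed

text \<open>Truncation is the quotient map: a component in \<open>S'\<close> can only be moved
  within \<open>S'\<close>, so discarding it before or after acting gives the same result.\<close>

lemma act_trunc:
  assumes "lower S' S" "a \<in> A" "h \<in> NS S"
  shows "trunc (S - S') (act S a h) = act (S - S') a (trunc (S - S') h)"
proof (intro ext)
  fix p q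
  have "a r q * h p r = a r q * trunc (S - S') h p r" if "(p, q) \<in> S - S'" for r
    using assms(1) A_D[OF assms(2), of r q] NS_D[OF assms(3), of p r] that unfolding lower_def trunc_def by auto
  then show "trunc (S - S') (act S a h) p q = act (S - S') a (trunc (S - S') h) p q"
    by (auto simp: trunc_def[of _ "act S a h"] act_apply intro: sum.cong)
qed

lemma trunc_id: "h \<in> NS S \<Longrightarrow> trunc S h = h"
  by (auto simp: fun_simps trunc_def NS_D)

lemma trunc_0: "h \<in> NS S' \<Longrightarrow> trunc (S - S') h = 0"
  by (auto simp: fun_simps trunc_def NS_D)

lemma trunc_eq_0: "h \<in> NS S \<Longrightarrow> trunc (S - S') h = 0 \<Longrightarrow> h \<in> NS S'"
  by (rule NS_I) (metis DiffI NS_D trunc_def zero_fun_apply)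

lemma delta_cong:
  "(\<And>as m. as \<in> tup i \<Longrightarrow> f as m = g as m) \<Longrightarrow> as \<in> tup (Suc i) \<Longrightarrow> delta S f as m = delta S g as m"
  unfolding delta_def using bt_cong[of i f g as m] by (auto simp: tup_Suc)

lemma delta_0: "(\<And>as m. as \<in> tup i \<Longrightarrow> f as m = 0) \<Longrightarrow> as \<in> tup (Suc i) \<Longrightarrow> delta S f as m = 0"
  using delta_cong[of i f "\<lambda>_ _. 0" as S m] bt_map[OF additive_0, of as i m]
  by (auto simp: tup_Suc delta_def act_lin)

lemma delta_add: "as \<in> tup (Suc i) \<Longrightarrow> delta S (\<lambda>as m. f as m + g as m) as m = delta S f as m + delta S g as m"
  unfolding delta_def by (simp add: bt_add[where i = i] act_lin algebra_simps)

lemma delta_diff: "as \<in> tup (Suc i) \<Longrightarrow> delta S (\<lambda>as m. f as m - g as m) as m = delta S f as m - delta S g as m"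
  using delta_add[of as i S "\<lambda>as m. f as m - g as m" g m] by simp

lemma delta_lower:
  "lower S' S \<Longrightarrow> coch S' i f \<Longrightarrow> as \<in> tup (Suc i) \<Longrightarrow> delta S f as m = delta S' f as m"
  by (auto simp: tup_Suc delta_def coch_in act_lower)

lemma delta_trunc:
  assumes "lower S' S" "coch S i f" "as \<in> tup (Suc i)"
  shows "delta (S - S') (\<lambda>as m. trunc (S - S') (f as m)) as m = trunc (S - S') (delta S f as m)"
  using assms bt_map[OF additive_trunc assms(3), of "S - S'" f m]
  by (auto simp: tup_Suc delta_def trunc_lin act_trunc coch_in)

lemma cob_0: "cob S 0 f \<longleftrightarrow> (\<forall>m. f [] m = 0)"
  by (simp add: cob_def)

lemma cob_Suc: "cob S (Suc i) f \<longleftrightarrow> (\<exists>g. coch S i g \<and> (\<forall>as\<in>tup (Suc i). \<forall>m. f as m = delta S g as m))"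
  by (simp add: cob_def)

lemma cob_cong: "(\<And>as m. as \<in> tup i \<Longrightarrow> f as m = g as m) \<Longrightarrow> cob S i f \<longleftrightarrow> cob S i g"
  by (cases i) (auto simp: cob_0 cob_Suc)

lemma cob_add: "cob S i f \<Longrightarrow> cob S i g \<Longrightarrow> cob S i (\<lambda>as m. f as m + g as m)"
proof (cases i)
  case (Suc j)
  assume "cob S i f" "cob S i g"
  then obtain f' g' where "coch S j f'" "\<forall>as\<in>tup i. \<forall>m. f as m = delta S f' as m"
    "coch S j g'" "\<forall>as\<in>tup i. \<forall>m. g as m = delta S g' as m"
    by (auto simp: Suc cob_Suc)
  then show ?thesis unfolding Suc cob_Suc
    by (intro exI[of _ "\<lambda>as m. f' as m + g' as m"]) (auto simp: delta_add coch_add)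
qed (auto simp: cob_0)

lemma cob_cocyc:
  assumes "convex S" "cob S i f" shows "cocyc S i f"
  unfolding cocyc_def
proof (intro ballI allI)
  fix as m assume as: "as \<in> tup (Suc i)"
  show "delta S f as m = 0"
  proof (cases i)
    case 0
    then show ?thesis using assms as by (intro delta_0[of i]) (auto simp: cob_0)
  next
    case (Suc j)
    then obtain g where g: "coch S j g" "\<And>as m. as \<in> tup i \<Longrightarrow> f as m = delta S g as m"
      using assms by (auto simp: cob_Suc)
    then show ?thesis
      using delta_cong[of i f "delta S g" as S m] delta_delta[OF assms(1) g(1)] as Suc by auto
  qed
qed

lemma cob_mono:
  assumes "lower S' S" "cob S' i f" shows "cob S i f"
proof (cases i)
  case 0
  then show ?thesis using assms by (simp add: cob_0)
next
  case (Suc j)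
  then obtain g where "coch S' j g" "\<forall>as\<in>tup i. \<forall>m. f as m = delta S' g as m"
    using assms by (auto simp: cob_Suc)
  then have "coch S j g" "\<forall>as\<in>tup i. \<forall>m. f as m = delta S g as m"
    using coch_mono delta_lower assms(1) Suc unfolding lower_def by (auto simp: lower_def)
  then show ?thesis using Suc by (auto simp: cob_Suc)
qed

lemma cob_trunc:
  assumes "lower S' S" "cob S i f" shows "cob (S - S') i (\<lambda>as m. trunc (S - S') (f as m))"
proof (cases i)
  case 0
  then show ?thesis using assms by (auto simp: cob_0 trunc_def fun_simps)
next
  case (Suc j)
  then obtain g where g: "coch S j g" "\<forall>as\<in>tup i. \<forall>m. f as m = delta S g as m"
    using assms by (auto simp: cob_Suc)
  then show ?thesis
    unfolding Suc cob_Suc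
    by (intro exI[of _ "\<lambda>as m. trunc (S - S') (g as m)"])
       (use coch_trunc delta_trunc[OF assms(1) g(1)] Suc in auto)
qed

text \<open>Take a cochain whose coboundary is the image in the quotient, extend it by zero to
  \<open>S\<close>, and subtract its coboundary from \<open>f\<close>. The difference truncates to
  zero and so has values in the submodule. In degree zero there is nothing to subtract.\<close>

lemma cohomologous_to_sub:
  assumes "convex S" "lower S' S" "coch S i f" "cob (S - S') i (\<lambda>as m. trunc (S - S') (f as m))"
  shows "\<exists>f1. coch S' i f1 \<and> cob S i (\<lambda>as m. f as m - f1 as m)"
proof (cases i)
  case 0
  have "coch S' 0 f"
  proof (rule coch_restrict[OF assms(3)[unfolded 0]])
    show "f as m \<in> NS S'" if "as \<in> tup 0" for as m
      using that assms(4) trunc_eq_0[OF coch_in[OF assms(3)]] by (simp add: 0 cob_0)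
  qed
  then show ?thesis by (intro exI[of _ f]) (auto simp: 0 cob_0)
next
  case (Suc j)
  let ?T = "S - S'"
  obtain g where g: "coch ?T j g" "\<And>as m. as \<in> tup i \<Longrightarrow> trunc ?T (f as m) = delta ?T g as m"
    using assms(4) unfolding Suc cob_Suc by auto
  have gS: "coch S j g" by (rule coch_mono[OF g(1)]) auto
  let ?f = "\<lambda>as m. f as m - delta S g as m"
  have c: "coch S i ?f"
    using coch_diff[OF assms(3)] coch_delta[OF gS] Suc by blast
  have "?f as m \<in> NS S'" if as: "as \<in> tup i" for as m
  proof (rule trunc_eq_0[OF coch_in[OF c as]])
    have "trunc ?T (?f as m) = delta ?T g as m - delta ?T (\<lambda>as m. trunc ?T (g as m)) as m"
      using as Suc g(2)[OF as] delta_trunc[OF assms(2) gS] by (simp add: trunc_lin)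
    also have "delta ?T (\<lambda>as m. trunc ?T (g as m)) as m = delta ?T g as m"
      using as Suc coch_in[OF g(1)] by (intro delta_cong[of j]) (auto simp: trunc_id)
    finally show "trunc ?T (?f as m) = 0" by simp
  qed
  then have "coch S' i ?f" by (rule coch_restrict[OF c])
  moreover have "cob S i (\<lambda>as m. f as m - ?f as m)"
    using gS by (auto simp: Suc cob_Suc)
  ultimately show ?thesis by blast
qed

lemma vanishI: "(\<And>f. coch S i f \<Longrightarrow> cocyc S i f \<Longrightarrow> cob S i f) \<Longrightarrow> vanish S i"
  and vanishD: "vanish S i \<Longrightarrow> coch S i f \<Longrightarrow> cocyc S i f \<Longrightarrow> cob S i f"
  unfolding vanish_iff by blast+

lemma cocyc_trunc:
  assumes "lower S' S" "coch S i f" "cocyc S i f"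
  shows "cocyc (S - S') i (\<lambda>as m. trunc (S - S') (f as m))"
  using assms by (auto simp: cocyc_def delta_trunc) (simp add: trunc_def fun_simps)

text \<open>Exactness at the middle term: a cocycle dies in the quotient, is therefore cohomologous
  to one from the submodule, and dies there.\<close>

lemma vanish_extension:
  assumes S: "convex S" "lower S' S" and v: "vanish S' i" "vanish (S - S') i"
  shows "vanish S i"
proof (rule vanishI)
  fix f assume f: "coch S i f" "cocyc S i f"
  have "cob (S - S') i (\<lambda>as m. trunc (S - S') (f as m))"
    by (rule vanishD[OF v(2) coch_trunc[OF f(1)] cocyc_trunc[OF S(2) f]])
  from cohomologous_to_sub[OF S f(1) this] obtain f1 where f1: "coch S' i f1" "cob S i (\<lambda>as m. f as m - f1 as m)" by blast
  have "cocyc S' i f1"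
    unfolding cocyc_def
  proof (intro ballI allI)
    fix as m assume as: "as \<in> tup (Suc i)"
    have "delta S f as m - delta S f1 as m = 0"
      using cob_cocyc[OF S(1) f1(2)] as delta_diff[OF as, of S f f1 m] unfolding cocyc_def by auto
    then show "delta S' f1 as m = 0" using f(2) as delta_lower[OF S(2) f1(1) as] unfolding cocyc_def by auto
  qed
  then have "cob S i f1" by (intro cob_mono[OF S(2)] vanishD[OF v(1) f1(1)])
  from cob_add[OF f1(2) this] show "cob S i f" by simp
qed

text \<open>A cocycle of the submodule is \<open>delta S g\<close> with \<open>g\<close> in the
  larger module. The image of \<open>g\<close> in the quotient is a cocycle, hence a coboundary, so
  \<open>g\<close> can be corrected to take values in the submodule.\<close>

lemma vanish_sub_Suc:
  assumes S: "convex S" "lower S' S" and v: "vanish S (Suc i)" "vanish (S - S') i"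
  shows "vanish S' (Suc i)"
proof (rule vanishI)
  fix f assume f: "coch S' (Suc i) f" "cocyc S' (Suc i) f"
  have "coch S (Suc i) f" by (rule coch_mono[OF f(1)]) (use S in \<open>simp add: lower_def\<close>)
  moreover have "cocyc S (Suc i) f"
    using f delta_lower[OF S(2) f(1)] unfolding cocyc_def by simp
  ultimately have "cob S (Suc i) f" by (rule vanishD[OF v(1)])
  then obtain g where g: "coch S i g" "\<And>as m. as \<in> tup (Suc i) \<Longrightarrow> f as m = delta S g as m"
    unfolding cob_Suc by blast
  have "cocyc (S - S') i (\<lambda>as m. trunc (S - S') (g as m))"
    unfolding cocyc_def
    using g(2)[symmetric] coch_in[OF f(1)] by (simp add: delta_trunc[OF S(2) g(1)] trunc_0)
  then have "cob (S - S') i (\<lambda>as m. trunc (S - S') (g as m))"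
    by (rule vanishD[OF v(2) coch_trunc[OF g(1)]])
  from cohomologous_to_sub[OF S g(1) this] obtain g1 where g1: "coch S' i g1" "cob S i (\<lambda>as m. g as m - g1 as m)" by blast
  have "f as m = delta S' g1 as m" if as: "as \<in> tup (Suc i)" for as m
    using cob_cocyc[OF S(1) g1(2)] as delta_diff[OF as, of S g g1 m] g(2)[OF as] delta_lower[OF S(2) g1(1) as]
    unfolding cocyc_def by auto
  then show "cob S' (Suc i) f" unfolding cob_Suc using g1(1) by blast
qed

lemma vanish_sub_0:
  assumes S: "lower S' S" and v: "vanish S 0"
  shows "vanish S' 0"
proof (rule vanishI)
  fix f assume f: "coch S' 0 f" "cocyc S' 0 f"
  have "coch S 0 f" by (rule coch_mono[OF f(1)]) (use S in \<open>simp add: lower_def\<close>)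
  moreover have "cocyc S 0 f"
    using f delta_lower[OF S f(1)] unfolding cocyc_def by simp
  ultimately have "cob S 0 f" by (rule vanishD[OF v(1)])
  then show "cob S' 0 f" by (simp add: cob_0)
qed

text \<open>Triviality of the connecting map: extend \<open>f\<close> by zero to \<open>S\<close>;
  its differential is a cocycle of the submodule, hence the differential of some \<open>h\<close>
  there. Then \<open>f - h\<close> is a cocycle on \<open>S\<close> with the same image in the
  quotient.\<close>

lemma vanish_quotient:
  assumes S: "convex S" "lower S' S" and v: "vanish S i" "vanish S' (Suc i)"
  shows "vanish (S - S') i"
proof (rule vanishI)
  let ?T = "S - S'"
  fix f assume f: "coch ?T i f" "cocyc ?T i f"
  have fS: "coch S i f" by (rule coch_mono[OF f(1)]) auto
  have tr: "trunc ?T (f as m) = f as m" if "as \<in> tup i" for as m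
    by (rule trunc_id[OF coch_in[OF f(1) that]])
  have d: "coch S' (Suc i) (delta S f)"
  proof (rule coch_restrict[OF coch_delta[OF fS]])
    fix as m assume as: "as \<in> tup (Suc i)"
    have "trunc ?T (delta S f as m) = delta ?T (\<lambda>as m. trunc ?T (f as m)) as m"
      by (rule delta_trunc[OF S(2) fS as, symmetric])
    also have "\<dots> = delta ?T f as m" by (rule delta_cong[OF tr as])
    also have "\<dots> = 0" using f(2) as unfolding cocyc_def by blast
    finally show "delta S f as m \<in> NS S'"
      using trunc_eq_0[OF coch_in[OF coch_delta[OF fS] as]] by blast
  qed
  have "cocyc S' (Suc i) (delta S f)"
    using delta_delta[OF S(1) fS] delta_lower[OF S(2) d] unfolding cocyc_def by simp
  then have "cob S' (Suc i) (delta S f)" by (rule vanishD[OF v(2) d])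
  then obtain h where h: "coch S' i h" "\<And>as m. as \<in> tup (Suc i) \<Longrightarrow> delta S f as m = delta S' h as m"
    unfolding cob_Suc by blast
  have hS: "coch S i h" by (rule coch_mono[OF h(1)]) (use S in \<open>simp add: lower_def\<close>)
  have "cocyc S i (\<lambda>as m. f as m - h as m)"
    using h(2) delta_lower[OF S(2) h(1)] unfolding cocyc_def by (simp add: delta_diff)
  then have "cob S i (\<lambda>as m. f as m - h as m)" by (rule vanishD[OF v(1) coch_diff[OF fS hS]])
  then have "cob ?T i (\<lambda>as m. trunc ?T (f as m - h as m))" by (rule cob_trunc[OF S(2)])
  moreover have "trunc ?T (f as m - h as m) = f as m" if "as \<in> tup i" for as m
    using tr[OF that] trunc_0[OF coch_in[OF h(1) that]] by (simp add: trunc_lin)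
  ultimately show "cob ?T i f" using cob_cong[of i "\<lambda>as m. trunc ?T (f as m - h as m)" f] by blast
qed

lemma vanish_empty: "vanish {} i"
proof (rule vanishI)
  fix f assume f: "coch {} i f" 
  have 0: "h = 0" if "h \<in> NS {}" for h using that NS_D[of h "{}"] by (auto simp: fun_simps)
  then have f0: "f as m = 0" if "as \<in> tup i" for as m using coch_in[OF f that] by blast
  show "cob {} i f"
  proof (cases i)
    case (Suc j)
    have "coch {} j (\<lambda>as m. 0)" for j
      by (induction j) (auto simp: coch_0 coch_Suc)
    then show ?thesis unfolding Suc cob_Suc
      by (intro exI[of _ "\<lambda>as m. 0"]) (use f0 Suc delta_0[of j "\<lambda>as m. 0"] in auto)
  qed (use f0 in \<open>auto simp: cob_0\<close>)
qed

text \<open>If \<open>S'\<close> and its complement are both down-sets, then \<open>N S'\<close> is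
  a direct summand, and truncation to \<open>S'\<close> is the projection that transports
  coboundaries back.\<close>

lemma vanish_disjoint_summand:
  assumes "convex S" "lower S' S" "lower (S - S') S" "vanish S i"
  shows "vanish S' i"
proof (rule vanishI)
  fix f assume f: "coch S' i f" "cocyc S' i f"
  have S': "S' \<subseteq> S" "S - (S - S') = S'" using assms(2) by (auto simp: lower_def)
  have "coch S i f" by (rule coch_mono[OF f(1) S'(1)])
  moreover have "cocyc S i f"
    using f delta_lower[OF assms(2) f(1)] unfolding cocyc_def by simp
  ultimately have "cob S i f" by (rule vanishD[OF assms(4)])
  from cob_trunc[OF assms(3) this] have "cob S' i (\<lambda>as m. trunc S' (f as m))" unfolding S'(2) .
  then show "cob S' i f"
    using cob_cong[of i "\<lambda>as m. trunc S' (f as m)" f] trunc_id coch_in[OF f(1)] by simp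
qed

subsection \<open>Injective representations and lifting involutions\<close>


text \<open>The matrix unit that represents the path class from \<open>x\<close> to
  \<open>r\<close>.\<close>

definition unit :: "'x \<Rightarrow> 'x \<Rightarrow> 'x \<Rightarrow> 'x \<Rightarrow> 'k" where
  "unit x r = (\<lambda>a b. if a = x \<and> b = r then 1 else 0)"

lemma unit_in: "le r x \<Longrightarrow> unit x r \<in> A"
  by (rule A_I) (auto simp: unit_def split: if_splits)

lemma sum_fun_apply: "(\<Sum>y\<in>Y. F y) x = (\<Sum>y\<in>Y. F y x)"
  by (induction Y rule: infinite_finite_induct) (auto simp: plus_fun_apply zero_fun_apply)

lemma unit_mul:
  assumes a: "a \<in> A" and x: "x \<in> P"
  shows "unit x r \<odot> a = (\<Sum>y\<in>{y. le x y}. scale (a y x) (unit y r))"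
proof (intro ext)
  fix p q
  have fin: "finite {y. le x y}" by (rule finite_subset[OF _ finP]) (use le_in in auto)
  have "(unit x r \<odot> a) p q = (\<Sum>t\<in>P. if t = x then (if q = r then a p x else 0) else 0)"
    unfolding mul_apply unit_def by (rule sum.cong) auto
  also have "\<dots> = (if q = r then a p x else 0)" using finP x by simp
  also have "\<dots> = (\<Sum>y\<in>{y. le x y}. if y = p then (if q = r then a p x else 0) else 0)"
    using fin A_D[OF a, of p x] by (auto simp: sum.delta)
  also have "\<dots> = (\<Sum>y\<in>{y. le x y}. scale (a y x) (unit y r) p q)"
    by (rule sum.cong) (auto simp: unit_def scale_apply)
  finally show "(unit x r \<odot> a) p q = (\<Sum>y\<in>{y. le x y}. scale (a y x) (unit y r)) p q"
    by (simp add: sum_fun_apply)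
qed

lemma coch_sum:
  assumes f: "coch S (Suc i) f" and as: "as \<in> tup i"
  shows "finite Y \<Longrightarrow> (\<And>y. y \<in> Y \<Longrightarrow> u y \<in> A) \<Longrightarrow>
    (\<Sum>y\<in>Y. scale (c y) (u y)) \<in> A \<and>
    f ((\<Sum>y\<in>Y. scale (c y) (u y)) # as) m = (\<Sum>y\<in>Y. scale (c y) (f (u y # as) m))"
proof (induction Y rule: finite_induct)
  case empty
  have z: "(0::'x \<Rightarrow> 'x \<Rightarrow> 'k) \<in> A" by (rule A_I) (simp add: zero_fun_apply)
  have "f (scale 0 0 # as) m = scale 0 (f (0 # as) m)"
    using f as z unfolding coch_Suc by blast
  moreover have "scale 0 h = 0" for h by (simp add: fun_simps scale_apply)
  ultimately show ?case using z by simp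
next
  case (insert y Y)
  then show ?case using f as unfolding coch_Suc by (auto simp: A_add A_scale)
qed

text \<open>The contracting homotopy below takes its value at \<open>x\<close> from the coordinate
  \<open>(p, r)\<close> of a cochain that itself depends on \<open>x\<close>; this shows that the
  assembled map is still a cochain.\<close>

lemma coch_pointwise:
  shows "(\<And>x. x \<in> X \<Longrightarrow> coch S i (F x)) \<Longrightarrow> (\<And>x. x \<in> X \<Longrightarrow> (p, x) \<in> S) \<Longrightarrow>
    coch S i (\<lambda>as m p' x. if p' = p \<and> x \<in> X then F x as m p r else 0)"
proof (induction i arbitrary: F)
  case 0
  then show ?case by (auto simp: coch_0 fun_simps scale_apply intro!: NS_I)
next
  case (Suc i)
  show ?case
    unfolding coch_Suc
  proof (intro conjI ballI allI)
    fix a assume "a \<in> A"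
    then show "coch S i (\<lambda>as m p' x. if p' = p \<and> x \<in> X then F x (a # as) m p r else 0)"
      using Suc by (intro Suc.IH) (auto simp: coch_Suc)
  qed (use Suc.prems in \<open>auto simp: coch_Suc fun_simps scale_apply\<close>)
qed

text \<open>The representation constant on \<open>{x. le r x}\<close> is the vector space dual of a projective right
  module, hence injective; evaluating at \<open>r\<close> after prepending the path from \<open>x\<close> to \<open>r\<close>
  is a contracting homotopy.\<close>

lemma vanish_injective:
  assumes r: "r \<in> P" "r \<noteq> v"
  shows "vanish ({p} \<times> {x. le r x}) i"
proof (rule vanishI)
  let ?S = "{p} \<times> {x. le r x}"
  fix f assume f: "coch ?S i f" "cocyc ?S i f"
  have act_unit: "act ?S (unit x r) h p r = h p x" if "le r x" for x h
  proof -
    have "act ?S (unit x r) h p r = (\<Sum>t\<in>P. if t = x then h p x else 0)"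
      unfolding act_apply unit_def using le_refl[OF r(1)] by (auto intro: sum.cong)
    then show ?thesis using finP le_in[OF that] by simp
  qed
  \<comment> \<open>This is the cocycle condition with the path from \<open>x\<close> to
    \<open>r\<close> prepended, read off at the coordinate \<open>(p, r)\<close>.\<close>
  have eq: "f as m p x = - bt f (unit x r # as) m p r" if "as \<in> tup i" "le r x" for as m x
  proof -
    have "delta ?S f (unit x r # as) m p r = 0"
      using f(2) that unit_in unfolding cocyc_def by (auto simp: zero_fun_apply)
    then show ?thesis
      using act_unit[OF that(2)] by (simp add: delta_def plus_fun_apply eq_neg_iff_add_eq_0)
  qed
  show "cob ?S i f"
  proof (cases i)
    case 0
    have "f [] m = 0" for m
    proof (intro ext)
      fix p' x
      have z: "f [] 0 = 0" using f(1) unfolding 0 coch_0 by (metis add_cancel_right_right add.right_neutral)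
      \<comment> \<open>Here the tail is \<open>f []\<close> applied to the action of
        \<open>unit x r\<close> on \<open>m\<close>, up to sign, and that action is zero because
        \<open>r \<noteq> v\<close>.\<close>
      have "f [] m p' x = 0" if "p' = p" "le r x"
        using eq[of "[]" x m] that 0 r z by (simp add: uminus_apply unit_def zero_fun_apply split: if_splits)
      moreover have "f [] m p' x = 0" if "\<not> (p' = p \<and> le r x)"
        using NS_D[OF coch_in[OF f(1)], of "[]" p' x m] that 0 by auto
      ultimately show "f [] m p' x = 0 p' x" by (auto simp: zero_fun_apply)
    qed
    then show ?thesis by (simp add: 0 cob_0)
  next
    case (Suc j)
    define g where "g = (\<lambda>as m p' x. if p' = p \<and> x \<in> {x. le r x} then f (unit x r # as) m p r else 0)"
    have g: "coch ?S j g"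
      unfolding g_def by (rule coch_pointwise) (use f(1) unit_in in \<open>auto simp: Suc coch_Suc\<close>)
    have "f as m = delta ?S g as m" if as: "as \<in> tup (Suc j)" for as m
    proof (intro ext)
      fix p' x
      obtain a bs where ab: "as = a # bs" "a \<in> A" "bs \<in> tup j" using as by (auto simp: tup_Suc)
      show "f as m p' x = delta ?S g as m p' x"
      proof (cases "p' = p \<and> le r x")
        case False
        then have "(p', x) \<notin> ?S" by auto
        then show ?thesis
          using NS_D[OF coch_in[OF f(1)]] NS_D[OF coch_in[OF coch_delta[OF g]]] as Suc by metis
      next
        case True
        then have p': "p' = p" and x: "le r x" by auto
        have xP: "x \<in> P" using le_in x by blast
        have fin: "finite {y. le x y}" by (rule finite_subset[OF _ finP]) (use le_in in auto)
        let ?e = "unit x r"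
        have "bt g as m p x = bar_tail Alg L (\<lambda>as m. g as m p x) as m"
          using bt_map[OF _ as, of "\<lambda>h. h p x" g m] by (simp add: additive_def plus_fun_apply)
        also have "(\<lambda>as m. g as m p x) = (\<lambda>as m. f (?e # as) m p r)"
          using x by (simp add: g_def)
        also have "bar_tail Alg L (\<lambda>as m. f (?e # as) m p r) as m = bt (\<lambda>as. f (?e # as)) as m p r"
          using bt_map[OF _ as, of "\<lambda>h. h p r" "\<lambda>as. f (?e # as)" m] by (simp add: additive_def plus_fun_apply)
        finally have bg: "bt g as m p x = bt (\<lambda>as. f (?e # as)) as m p r" .
        \<comment> \<open>Expanding \<open>?e \<odot> a\<close> into paths ending at
          \<open>r\<close> turns this value into the action of \<open>a\<close> on the homotopy
          \<open>g\<close>, the leading term of \<open>delta ?S g\<close>.\<close>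
        have "f (?e \<odot> a # bs) m p r = (\<Sum>y\<in>{y. le x y}. a y x * f (unit y r # bs) m p r)"
          using coch_sum[OF f(1)[unfolded Suc] ab(3) fin, of "\<lambda>y. unit y r" "\<lambda>y. a y x" m]
            unit_mul[OF ab(2) xP, of r] unit_in le_trans[OF x]
          by (simp add: sum_fun_apply scale_apply)
        also have "\<dots> = (\<Sum>y\<in>{y. le x y}. a y x * g bs m p y)"
          using le_trans[OF x] by (intro sum.cong) (auto simp: g_def)
        also have "\<dots> = (\<Sum>y\<in>P. a y x * g bs m p y)"
          by (rule sum.mono_neutral_left) (use finP le_in A_D[OF ab(2)] in auto)
        also have "\<dots> = act ?S a (g bs m) p x"
          using x by (simp add: act_apply)
        finally have fa: "f (?e \<odot> a # bs) m p r = act ?S a (g bs m) p x" .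
        have "f as m p x = f (?e \<odot> a # bs) m p r + bt (\<lambda>as. f (?e # as)) as m p r"
          using eq[OF as[folded Suc] x, of m] by (simp add: ab minus_apply uminus_apply)
        then show ?thesis unfolding p' fa bg[symmetric]
          by (simp add: delta_def ab plus_fun_apply)
      qed
    qed
    then show ?thesis unfolding Suc cob_Suc using g by blast
  qed
qed

text \<open>The lifting property of right multiplication by a simple reflection, stated for an
  involution of an arbitrary poset. Fixed points are allowed, so that single points count as
  degenerate pairs.\<close>

definition lifting :: "('x \<Rightarrow> 'x) \<Rightarrow> bool" where
  "lifting \<tau> \<longleftrightarrow> (\<forall>x\<in>P. \<tau> x \<in> P \<and> \<tau> (\<tau> x) = x \<and> (le x (\<tau> x) \<or> le (\<tau> x) x))
    \<and> (\<forall>x y. le x y \<and> le x (\<tau> x) \<and> le (\<tau> y) y \<longrightarrow> le x (\<tau> y))"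

lemma lifting_id: "lifting (\<lambda>x. x)"
  by (auto simp: lifting_def le_refl)

text \<open>The smaller of \<open>x\<close> and \<open>\<tau> x\<close> lies below
  \<open>\<tau> q\<close>, and the lifting property moves it below \<open>q\<close>.\<close>

lemma lifting_below:
  assumes \<tau>: "lifting \<tau>" and q: "le q (\<tau> q)" and x: "le x (\<tau> q)"
  shows "le x q \<or> le (\<tau> x) q"
proof -
  have P: "x \<in> P" "q \<in> P" using q x le_in by blast+
  have tt: "\<tau> (\<tau> q) = q" "\<tau> (\<tau> x) = x" using \<tau> P unfolding lifting_def by auto
  have *: "le y q" if "le y (\<tau> q)" "le y (\<tau> y)" for y
    using \<tau> that q tt unfolding lifting_def by metis
  have "le x (\<tau> x) \<or> le (\<tau> x) x" using \<tau> P unfolding lifting_def by blast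
  then show ?thesis using *[of x] *[of "\<tau> x"] x tt le_trans by metis
qed

lemma convex_diff: "convex S \<Longrightarrow> lower B S \<Longrightarrow> convex (S - B)"
  unfolding convex_def lower_def by blast

text \<open>A minimal \<open>q\<close> of a fibre and its partner form a down-set of
  \<open>S\<close>; splitting it off by the long exact sequence leaves a smaller stable convex set.
  The involution may vary with the fibre.\<close>

lemma vanish_blocks:
  assumes "finite S" "convex S" "\<And>p. lifting (\<tau> p)" "\<And>p q. (p, q) \<in> S \<Longrightarrow> q \<in> P \<and> (p, \<tau> p q) \<in> S"
    "\<And>p q. (p, q) \<in> S \<Longrightarrow> le q (\<tau> p q) \<Longrightarrow> vanish ({p} \<times> {q, \<tau> p q}) i"
  shows "vanish S i"
  using assms(1,2,4,5)
proof (induction S rule: finite_psubset_induct)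
  case (psubset S)
  show ?case
  proof (cases "S = {}")
    case True
    then show ?thesis by (simp add: vanish_empty)
  next
    case False
    then obtain p q0 where "(p, q0) \<in> S" by auto
    let ?Q = "{q. (p, q) \<in> S}"
    have "finite ?Q" by (rule finite_subset[of _ "snd ` S"]) (use psubset.hyps in force)+
    moreover have "asymp_on ?Q (\<lambda>x y. le x y \<and> x \<noteq> y)" "transp_on ?Q (\<lambda>x y. le x y \<and> x \<noteq> y)"
      using le_antisym le_trans unfolding asymp_on_def transp_on_def by metis+
    ultimately obtain q where q: "q \<in> ?Q" "\<And>x. x \<in> ?Q \<Longrightarrow> x \<noteq> q \<Longrightarrow> \<not> (le x q \<and> x \<noteq> q)"
      using Finite_Set.bex_min_element[of ?Q "\<lambda>x y. le x y \<and> x \<noteq> y"] \<open>(p, q0) \<in> S\<close> by blast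
    have qS: "(p, q) \<in> S" "q \<in> P" "(p, \<tau> p q) \<in> S" using q psubset.prems by auto
    have q\<tau>: "le q (\<tau> p q)"
    proof -
      have "le q (\<tau> p q) \<or> le (\<tau> p q) q" using assms(3)[of p] qS unfolding lifting_def by blast
      then show ?thesis using q(2)[of "\<tau> p q"] qS by fastforce
    qed
    let ?B = "{p} \<times> {q, \<tau> p q}"
    have low: "lower ?B S"
      unfolding lower_def
    proof (intro conjI allI impI)
      fix p' x y assume *: "(p', y) \<in> ?B \<and> (p', x) \<in> S \<and> le x y"
      then have x: "p' = p" "(p, x) \<in> S" "le x (\<tau> p q)" using q\<tau> le_trans by auto
      have "(p, \<tau> p x) \<in> S" using psubset.prems(2)[OF x(2)] by blast
      \<comment> \<open>One of \<open>x\<close> and its partner lies below \<open>q\<close>, and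
        both are in the fibre, so minimality of \<open>q\<close> applies.\<close>
      then have "x = q \<or> \<tau> p x = q"
        using lifting_below[OF assms(3) q\<tau> x(3)] q(2)[of x] q(2)[of "\<tau> p x"] x(2) by blast
      moreover have "\<tau> p (\<tau> p x) = x"
        using assms(3)[of p] psubset.prems(2)[OF x(2)] unfolding lifting_def by blast
      ultimately show "(p', x) \<in> ?B" using x by auto
    qed (use qS in auto)
    have "vanish (S - ?B) i"
    proof (rule psubset.IH)
      show "convex (S - ?B)" by (rule convex_diff[OF psubset.prems(1) low])
      fix p' x assume *: "(p', x) \<in> S - ?B"
      have x: "x \<in> P" "(p', \<tau> p' x) \<in> S" using psubset.prems(2)[of p' x] * by auto
      have "\<tau> p' (\<tau> p' x) = x" "\<tau> p (\<tau> p q) = q"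
        using assms(3)[of p'] assms(3)[of p] x qS(2) unfolding lifting_def by auto
      then show "x \<in> P \<and> (p', \<tau> p' x) \<in> S - ?B" using * x by auto
    qed (use psubset.prems qS in auto)
    moreover have "vanish ?B i" by (rule psubset.prems(3)[OF qS(1) q\<tau>])
    ultimately show ?thesis using vanish_extension[OF psubset.prems(1) low] by blast
  qed
qed

text \<open>Induction on the number of elements above \<open>q\<close>. The pair is the bottom of
  the injective representation on all these elements, and the rest is filtered by pairs with larger
  bottom element. Passing to the submodule lowers the degree needed for the quotient, so the degree
  is kept arbitrary in the induction.\<close>

lemma vanish_pair:
  assumes \<tau>: "lifting \<tau>"
  shows "le q (\<tau> q) \<Longrightarrow> (\<And>x. le q x \<Longrightarrow> le x (\<tau> x) \<Longrightarrow> x \<noteq> v) \<Longrightarrow> vanish ({p} \<times> {q, \<tau> q}) i"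
proof (induction "card {x. le q x}" arbitrary: q i rule: less_induct)
  case (less q i)
  have qP: "q \<in> P" using less.prems le_in by blast
  let ?S = "{p} \<times> {x. le q x}" and ?B = "{p} \<times> {q, \<tau> q}"
  have fin: "finite {x. le y x}" for y by (rule finite_subset[OF _ finP]) (use le_in in auto)
  have inv: "\<tau> (\<tau> x) = x" if "le q x" for x using \<tau> le_in that unfolding lifting_def by blast
  \<comment> \<open>Only the case \<open>\<tau> x \<le> x\<close> is at issue; there the lifting
    property applies because \<open>q \<le> \<tau> q\<close>.\<close>
  have stable: "le q (\<tau> x)" if "le q x" for x
  proof -
    have "le x (\<tau> x) \<or> le (\<tau> x) x" using \<tau> le_in that unfolding lifting_def by blast
    then show ?thesis using that less.prems(1) \<tau> le_trans unfolding lifting_def by blast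
  qed
  have S: "convex ?S" unfolding convex_def using le_trans by blast
  have low: "lower ?B ?S"
    unfolding lower_def
  proof (intro conjI allI impI)
    fix p' x y assume *: "(p', y) \<in> ?B \<and> (p', x) \<in> ?S \<and> le x y"
    then have x: "p' = p" "le q x" "le x (\<tau> q)" using less.prems(1) le_trans by auto
    then have "x = q \<or> \<tau> x = q"
      using lifting_below[OF \<tau> less.prems(1) x(3)] stable le_antisym by blast
    then show "(p', x) \<in> ?B" using x inv by auto
  qed (use less.prems(1) qP le_refl in auto)
  have rest: "vanish (?S - ?B) j" for j
  proof (rule vanish_blocks[where \<tau> = "\<lambda>_. \<tau>"])
    show "finite (?S - ?B)" using fin by simp
    show "convex (?S - ?B)" by (rule convex_diff[OF S low])
    fix p' x assume *: "(p', x) \<in> ?S - ?B"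
    then show "x \<in> P \<and> (p', \<tau> x) \<in> ?S - ?B" using le_in stable inv[of x] inv[of q] le_refl[OF qP] by auto
    assume "le x (\<tau> x)"
    then have "vanish ({p} \<times> {x, \<tau> x}) j"
    proof (intro less.hyps)
      show "card {y. le x y} < card {y. le q y}"
      proof (rule psubset_card_mono[OF fin])
        have "q \<notin> {y. le x y}" using * le_antisym by auto
        then show "{y. le x y} \<subset> {y. le q y}" using * le_trans le_refl[OF qP] by blast
      qed
      show "y \<noteq> v" if "le x y" "le y (\<tau> y)" for y using less.prems(2) * that le_trans by blast
    qed
    then show "vanish ({p'} \<times> {x, \<tau> x}) j" using * by simp
  qed (rule \<tau>)
  \<comment> \<open>The hypothesis on bottoms of pairs applies to \<open>q\<close> itself, as the
    injectivity lemma requires.\<close>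
  have "q \<noteq> v" using less.prems le_refl[OF qP] by blast
  then have all: "vanish ?S j" for j by (rule vanish_injective[OF qP])
  show ?case
  proof (cases i)
    case 0
    then show ?thesis using vanish_sub_0[OF low all] by simp
  next
    case (Suc j)
    then show ?thesis using vanish_sub_Suc[OF S low all rest] by simp
  qed
qed

text \<open>The two-element representation has the simple module at \<open>q\<close> as submodule
  and the one at \<open>\<tau> q\<close> as quotient. Its own Ext groups are zero, so the connecting
  maps are isomorphisms.\<close>

lemma vanish_shift:
  assumes \<tau>: "lifting \<tau>" and q: "le q (\<tau> q)" "q \<noteq> \<tau> q"
    and v: "\<And>x. le q x \<Longrightarrow> le x (\<tau> x) \<Longrightarrow> x \<noteq> v"
  shows "vanish {(p, q)} (Suc i) \<longleftrightarrow> vanish {(p, \<tau> q)} i" "vanish {(p, q)} 0"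
proof -
  let ?S = "{p} \<times> {q, \<tau> q}"
  have inv: "\<tau> (\<tau> x) = x" if "le q x" for x using \<tau> le_in that unfolding lifting_def by blast
  have all: "vanish ?S j" for j by (rule vanish_pair[OF \<tau> q(1) v])
  have S: "convex ?S"
    unfolding convex_def
  proof (intro allI impI)
    fix p' x y z assume "(p', x) \<in> ?S \<and> (p', z) \<in> ?S \<and> le x y \<and> le y z"
    then have y: "p' = p" "le q y" "le y (\<tau> q)" using q(1) le_trans by auto
    have "le y (\<tau> y) \<or> le (\<tau> y) y" using \<tau> le_in y(2) unfolding lifting_def by blast
    then have "le q (\<tau> y)" using y(2) q(1) \<tau> le_trans unfolding lifting_def by blast
    then have "y = q \<or> \<tau> y = q" using lifting_below[OF \<tau> q(1) y(3)] y(2) le_antisym by blast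
    then show "(p', y) \<in> ?S" using y inv by auto
  qed
  have low: "lower {(p, q)} ?S"
    using q le_antisym unfolding lower_def by auto
  have diff: "?S - {(p, q)} = {(p, \<tau> q)}" using q by auto
  show "vanish {(p, q)} (Suc i) \<longleftrightarrow> vanish {(p, \<tau> q)} i"
    using vanish_quotient[OF S low all] vanish_sub_Suc[OF S low all] unfolding diff by blast
  show "vanish {(p, q)} 0" by (rule vanish_sub_0[OF low all])
qed

section \<open>From simple modules to the regular module\<close>

lemma not_vanish_top: "\<not> vanish {(p, v)} 0"
proof
  \<comment> \<open>The witness is the isomorphism of \<open>L\<close> onto the copy of the simple
    module at \<open>v\<close> in the fibre over \<open>p\<close>.\<close>
  let ?f = "\<lambda>(as :: ('x \<Rightarrow> 'x \<Rightarrow> 'k) list) (m :: 'k) (a :: 'x) (b :: 'x). if a = p \<and> b = v then m else 0"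
  assume v: "vanish {(p, v)} 0"
  have "coch {(p, v)} 0 ?f" by (auto simp: coch_0 fun_simps scale_apply intro!: NS_I split: if_splits)
  moreover have "cocyc {(p, v)} 0 ?f"
    using finP vP by (auto simp: cocyc_def tup_Suc delta_def fun_simps act_apply if_distrib[of "(*) _"] cong: if_cong)
  ultimately have "cob {(p, v)} 0 ?f" by (rule vanishD[OF v])
  then have "\<forall>m. ?f [] m = 0" by (simp add: cob_0)
  from fun_cong[OF fun_cong[OF spec[OF this, of 1], of p], of v] show False
    by (simp add: zero_fun_apply)
qed

text \<open>Each passage from \<open>q\<close> to \<open>\<tau> q\<close> raises \<open>len\<close>
  by one and lowers the cohomological degree by one, until \<open>v\<close> is reached and Hom is
  nonzero. The involution may change at every passage.\<close>

lemma vanish_below_top: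
  fixes len :: "'x \<Rightarrow> nat"
  assumes mono: "\<And>q. le q v \<Longrightarrow> len q \<le> len v"
    and up: "\<And>q. le q v \<Longrightarrow> q \<noteq> v \<Longrightarrow> \<exists>\<tau>. lifting \<tau> \<and> le q (\<tau> q) \<and> len (\<tau> q) = Suc (len q)
        \<and> le (\<tau> q) v \<and> (\<forall>x. le x (\<tau> x) \<longrightarrow> x \<noteq> v)"
  shows "le q v \<Longrightarrow> (\<forall>i < len v - len q. vanish {(p, q)} i) \<and> \<not> vanish {(p, q)} (len v - len q)"
proof (induction "len v - len q" arbitrary: q)
  case 0
  have "q = v"
  proof (rule ccontr)
    assume "q \<noteq> v"
    then obtain \<tau> where "len (\<tau> q) = Suc (len q)" "le (\<tau> q) v" using up[OF 0(2)] by blast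
    then show False using mono 0 by fastforce
  qed
  then show ?case using not_vanish_top by simp
next
  case (Suc d)
  then have "q \<noteq> v" by auto
  then obtain \<tau> where \<tau>: "lifting \<tau>" "le q (\<tau> q)" "len (\<tau> q) = Suc (len q)" "le (\<tau> q) v"
    "\<And>x. le x (\<tau> x) \<Longrightarrow> x \<noteq> v"
    using up[OF Suc.prems] by blast
  have d: "len v - len (\<tau> q) = d" "len v - len q = Suc d" using Suc(2) \<tau>(3) by auto
  note IH = Suc.hyps(1)[OF d(1)[symmetric] \<tau>(4), unfolded d(1)]
  have ne: "q \<noteq> \<tau> q" using \<tau>(3) by auto
  note shift = vanish_shift[OF \<tau>(1,2) ne \<tau>(5)]
  show ?case unfolding d(2)
  proof (intro conjI allI impI)
    fix i assume "i < Suc d"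
    then show "vanish {(p, q)} i" using IH shift by (cases i) auto
  next
    show "\<not> vanish {(p, q)} (Suc d)" using IH shift by blast
  qed
qed

text \<open>The elements below \<open>v\<close> form a down-set \<open>?D\<close> of each fibre.
  There the dichotomy gives either the single point \<open>e\<close> or a stable set filtered by
  pairs; the remaining elements contribute nothing. Nonvanishing in degree \<open>d\<close> comes
  from the fibre over \<open>e\<close> alone.\<close>

lemma vanish_regular:
  assumes bot: "\<And>p. p \<in> P \<Longrightarrow> le e p"
    and low: "\<And>i. i < d \<Longrightarrow> \<forall>p. vanish {(p, e)} i" and nz: "\<not> vanish {(e, e)} d"
    and dich: "\<And>p. p \<in> P \<Longrightarrow> (\<forall>q. le q p \<and> le q v \<longrightarrow> q = e) \<or>
      (\<exists>\<tau>. lifting \<tau> \<and> (\<forall>x. le x (\<tau> x) \<longrightarrow> x \<noteq> v) \<and> (\<forall>q. le q p \<and> le q v \<longrightarrow> le (\<tau> q) p \<and> le (\<tau> q) v))"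
  shows "(\<forall>i<d. vanish {(p, q). le q p} i) \<and> \<not> vanish {(p, q). le q p} d"
proof (intro conjI allI impI)
  let ?S = "{(p, q). le q p}" and ?D = "{(p, q). le q p \<and> le q v}"
  have fin: "finite ?S" by (rule finite_subset[of _ "P \<times> P"]) (use finP le_in in auto)
  have S: "convex ?S" unfolding convex_def using le_trans by blast
  fix i assume i: "i < d"
  have D: "lower ?D ?S" unfolding lower_def using le_trans by blast
  have ex: "\<exists>\<tau>. lifting \<tau> \<and> (\<forall>q. (p, q) \<in> ?D \<longrightarrow> (p, \<tau> q) \<in> ?D \<and> (le q (\<tau> q) \<longrightarrow> vanish ({p} \<times> {q, \<tau> q}) i))"
    (is "\<exists>\<tau>. ?Q p \<tau>") for p
  proof (cases "p \<in> P \<and> \<not> (\<forall>q. le q p \<and> le q v \<longrightarrow> q = e)")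
    case True
    then obtain \<tau> where "lifting \<tau>" "\<forall>x. le x (\<tau> x) \<longrightarrow> x \<noteq> v" "\<forall>q. le q p \<and> le q v \<longrightarrow> le (\<tau> q) p \<and> le (\<tau> q) v"
      using dich[of p] by blast
    then show ?thesis using vanish_pair[of \<tau>] by (intro exI[of _ \<tau>]) auto
  next
    case False
    then have "q = e" if "(p, q) \<in> ?D" for q using that le_in by auto
    then show ?thesis using lifting_id low[OF i] by (intro exI[of _ "\<lambda>x. x"]) auto
  qed
  define \<tau> where "\<tau> = (\<lambda>p. SOME \<tau>. ?Q p \<tau>)"
  have "?Q p (\<tau> p)" for p
    unfolding \<tau>_def by (rule someI_ex[OF ex])
  then have \<tau>: "\<And>p. lifting (\<tau> p)"
      "\<And>p q. (p, q) \<in> ?D \<Longrightarrow> (p, \<tau> p q) \<in> ?D \<and> (le q (\<tau> p q) \<longrightarrow> vanish ({p} \<times> {q, \<tau> p q}) i)"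
    by blast+
  have "vanish ?D i"
  proof (rule vanish_blocks[of _ \<tau>])
    show "finite ?D" by (rule finite_subset[OF _ fin]) auto
    show "convex ?D" unfolding convex_def using le_trans by blast
    show "q \<in> P \<and> (p, \<tau> p q) \<in> ?D" if "(p, q) \<in> ?D" for p q using \<tau>(2)[OF that] that le_in by blast
    show "vanish ({p} \<times> {q, \<tau> p q}) i" if "(p, q) \<in> ?D" "le q (\<tau> p q)" for p q using \<tau>(2) that by blast
  qed (rule \<tau>)
  \<comment> \<open>An element not below \<open>v\<close> has nothing above it equal to
    \<open>v\<close>, so the identity involution already gives vanishing at each single
    point.\<close>
  moreover have "vanish (?S - ?D) i"
  proof (rule vanish_blocks[of _ "\<lambda>_ x. x"])
    show "finite (?S - ?D)" using fin by simp
    show "convex (?S - ?D)" by (rule convex_diff[OF S D])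
    fix p q assume q: "(p, q) \<in> ?S - ?D"
    then show "q \<in> P \<and> (p, q) \<in> ?S - ?D" using le_in by auto
    show "vanish ({p} \<times> {q, q}) i" by (rule vanish_pair[OF lifting_id]) (use q le_in le_refl in auto)
  qed (rule lifting_id)
  ultimately show "vanish ?S i" by (rule vanish_extension[OF S D])
next
  let ?S = "{(p, q). le q p}"
  have S: "convex ?S" unfolding convex_def using le_trans by blast
  have e: "le e e" using bot vP le_in by blast
  have e': "x = e" if "le x e" for x using that bot le_in le_antisym by blast
  \<comment> \<open>The fibre over the bottom element is a single point, hence a direct
    summand.\<close>
  have "lower {(e, e)} ?S" "lower (?S - {(e, e)}) ?S" unfolding lower_def using e e' by auto
  from vanish_disjoint_summand[OF S this] nz show "\<not> vanish ?S d" by blast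
qed

text \<open>The fibre over \<open>p\<close> is the projective module of paths starting at
  \<open>p\<close>. The product and the truncated action agree because a product of algebra elements
  is again supported where \<open>le q p\<close>.\<close>

lemma ext_nonzero_regular: "ext_nonzero Alg L (regular Alg) i \<longleftrightarrow> \<not> vanish {(p, q). le q p} i"
proof -
  let ?S = "{(p, q). le q p}"
  have car: "mcarrier (regular Alg) = NS ?S"
    using le_in by (auto simp: regular_def Alg_def N_def)
  have sc: "mscal (regular Alg) = scale" by (simp add: regular_def)
  have coch: "cochain Alg L (regular Alg) i f \<longleftrightarrow> coch ?S i f" for i f
    unfolding cochain_def car sc mscal_N ..
  have act: "mact (regular Alg) a h = act ?S a h" if "a \<in> A" "h \<in> NS ?S" for a h
  proof (intro ext)
    fix p q
    have "h \<in> A" using that(2) car by (simp add: regular_def)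
    then have "(a \<odot> h) p q = 0" if "\<not> le q p" using A_D[OF A_mul[OF \<open>a \<in> A\<close>]] that by blast
    then show "mact (regular Alg) a h p q = act ?S a h p q"
      by (auto simp: regular_def act_apply mul_apply)
  qed
  have dcob: "dcob Alg L (regular Alg) i f as m = dcob Alg L (N ?S) i f as m"
    if "coch ?S i f" "as \<in> tup (Suc i)" for i f as m
    using that act coch_in unfolding dcob_def sc mscal_N by (auto simp: tup_Suc)
  show ?thesis
    unfolding vanish_def ext_nonzero_def coboundary_def coch cargs_iff
    using dcob by (cases i) (auto; metis)+
qed

end

section \<open>Bruhat order\<close>

definition inversions :: "perm \<Rightarrow> (nat \<times> nat) set" where
  "inversions u = {(a, b). a < b \<and> u b < u a}"

definition inv_num :: "perm \<Rightarrow> nat" where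
  "inv_num u = card (inversions u)"

lemma Sn_bij: "u \<in> Sn n \<Longrightarrow> bij u"
  by (simp add: Sn_def permutes_bij)

lemma Sn_inj: "u \<in> Sn n \<Longrightarrow> u a = u b \<longleftrightarrow> a = b"
  using Sn_bij bij_def inj_eq by metis

lemma Sn_lt: "u \<in> Sn n \<Longrightarrow> u a < n \<longleftrightarrow> a < n"
  using permutes_in_image[of u "{..<n}" a] by (simp add: Sn_def)

lemma Sn_ge: "u \<in> Sn n \<Longrightarrow> n \<le> a \<Longrightarrow> u a = a"
  using permutes_not_in[of u "{..<n}" a] by (simp add: Sn_def)

lemma Sn_comp: "u \<in> Sn n \<Longrightarrow> w \<in> Sn n \<Longrightarrow> u \<circ> w \<in> Sn n"
  by (simp add: Sn_def permutes_compose)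

lemma Sn_id: "id \<in> Sn n"
  by (simp add: Sn_def permutes_id)

lemma Sn_transpose: "i < n \<Longrightarrow> j < n \<Longrightarrow> transpose i j \<in> Sn n"
  by (simp add: Sn_def permutes_swap_id)

lemma Sn_sref: "Suc k < n \<Longrightarrow> sref k \<in> Sn n"
  unfolding sref_def by (rule Sn_transpose) auto

lemma finite_Sn: "finite (Sn n)"
  unfolding Sn_def by (simp add: finite_permutations)

lemma sref_sref [simp]: "u \<circ> sref k \<circ> sref k = u"
  by (simp add: sref_def fun_eq_iff)

lemma sref_simps [simp]: "sref k k = Suc k" "sref k (Suc k) = k"
  by (simp_all add: sref_def)

lemma sref_strict_mono: "a < b \<Longrightarrow> (a, b) \<noteq> (k, Suc k) \<Longrightarrow> sref k a < sref k b"
  by (auto simp: sref_def transpose_def)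

lemma inv_num_id [simp]: "inv_num id = 0"
proof -
  have "inversions id = {}" by (auto simp: inversions_def)
  then show ?thesis by (simp add: inv_num_def)
qed

lemma transpose_eq_transpose_iff: "transpose i j a = transpose i j b \<longleftrightarrow> a = b"
  by (metis transpose_involutory)

lemma inversions_sub:
  assumes "u \<in> Sn n" shows "inversions u \<subseteq> {..<n} \<times> {..<n}"
proof -
  have "b < n" if "a < b" "u b < u a" for a b
  proof (rule ccontr)
    assume "\<not> b < n"
    then show False using that Sn_ge[OF assms, of b] Sn_ge[OF assms, of a] Sn_lt[OF assms, of a] by (cases "a < n") auto
  qed
  then show ?thesis by (force simp: inversions_def)
qed

lemma finite_inversions: "u \<in> Sn n \<Longrightarrow> finite (inversions u)"
  by (rule finite_subset[OF inversions_sub]) auto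

text \<open>Transporting a pair of positions along the transposition when this keeps its order, and
  leaving it alone otherwise, injects the old inversions into the new ones and misses
  \<open>(i, j)\<close>.\<close>

lemma inv_num_transpose:
  assumes u: "u \<in> Sn n" and ij: "i < j" "j < n" and lt: "u i < u j"
  shows "inv_num u < inv_num (u \<circ> transpose i j)"
proof -
  let ?t = "transpose i j"
  let ?w = "u \<circ> ?t"
  let ?\<phi> = "\<lambda>(a, b). if ?t a < ?t b then (?t a, ?t b) else (a, b)"
  have w: "?w \<in> Sn n" using u ij Sn_comp Sn_transpose by simp
  have inj: "inj_on ?\<phi> (inversions u)"
  proof (rule inj_onI, clarify)
    fix a b c d assume *: "(a, b) \<in> inversions u" "(c, d) \<in> inversions u" 
      and eq: "(if ?t a < ?t b then (?t a, ?t b) else (a, b)) = (if ?t c < ?t d then (?t c, ?t d) else (c, d))"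
    have "a < b" "c < d" using * by (auto simp: inversions_def)
    then show "a = c \<and> b = d"
      using eq by (auto simp: transpose_eq_transpose_iff split: if_splits)
  qed
  have sub: "?\<phi> ` inversions u \<subseteq> inversions ?w - {(i, j)}"
  proof (rule image_subsetI)
    fix x assume "x \<in> inversions u"
    then obtain a b where x: "x = (a, b)" and ab: "a < b" "u b < u a" by (auto simp: inversions_def)
    have "(if ?t a < ?t b then (?t a, ?t b) else (a, b)) \<in> inversions ?w - {(i, j)}"
    proof (cases "?t a < ?t b")
      case True
      have "(?t a, ?t b) \<noteq> (i, j)" using ab ij by (metis transpose_apply_first transpose_apply_second transpose_involutory Pair_inject not_less_iff_gr_or_eq)
      then show ?thesis using True ab by (simp add: inversions_def)
    next
      case False
      have "(a, b) \<noteq> (i, j)" using ab lt by auto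
      \<comment> \<open>An inversion reversed by the swap shares one endpoint with
        \<open>(i, j)\<close> and has its other endpoint strictly between; since
        \<open>u i < u j\<close>, it remains an inversion as it stands.\<close>
      with False ab ij have "a = i \<and> i < b \<and> b < j \<or> b = j \<and> i < a \<and> a < j"
        by (auto simp: transpose_def split: if_splits)
      then show ?thesis
        using False ab lt ij by (auto simp: inversions_def transpose_def)
    qed
    then show "?\<phi> x \<in> inversions ?w - {(i, j)}" by (simp only: x prod.case)
  qed
  have "inv_num u \<le> card (inversions ?w - {(i, j)})"
    unfolding inv_num_def using card_inj_on_le[OF inj sub] finite_inversions[OF w] by simp
  also have "\<dots> < inv_num ?w"
    unfolding inv_num_def
    by (rule card_Diff1_less[OF finite_inversions[OF w]]) (use ij lt in \<open>simp add: inversions_def\<close>)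
  finally show ?thesis .
qed

text \<open>A simple reflection keeps the order of every pair of positions except
  \<open>(k, Suc k)\<close>; all other inversions are carried along bijectively.\<close>

lemma inv_num_sref:
  assumes u: "u \<in> Sn n" and lt: "u k < u (Suc k)"
  shows "inv_num (u \<circ> sref k) = Suc (inv_num u)"
proof -
  let ?s = "sref k"
  have "inversions (u \<circ> ?s) = insert (k, Suc k) ((\<lambda>(a, b). (?s a, ?s b)) ` inversions u)"
  proof (intro equalityI subsetI)
    fix x assume "x \<in> inversions (u \<circ> ?s)"
    then obtain a b where x: "x = (a, b)" "a < b" "u (?s b) < u (?s a)" by (auto simp: inversions_def)
    show "x \<in> insert (k, Suc k) ((\<lambda>(a, b). (?s a, ?s b)) ` inversions u)"
    proof (cases "x = (k, Suc k)")
      case False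
      then have "(?s a, ?s b) \<in> inversions u" using x sref_strict_mono[of a b k] by (auto simp: inversions_def)
      moreover have "x = (?s (?s a), ?s (?s b))" using x by (simp add: sref_def)
      ultimately show ?thesis by force
    qed simp
  next
    fix x assume "x \<in> insert (k, Suc k) ((\<lambda>(a, b). (?s a, ?s b)) ` inversions u)"
    then consider "x = (k, Suc k)" | a b where "x = (?s a, ?s b)" "a < b" "u b < u a"
      by (auto simp: inversions_def)
    then show "x \<in> inversions (u \<circ> ?s)"
    proof cases
      case 2
      then have "(a, b) \<noteq> (k, Suc k)" using lt by auto
      then have "?s a < ?s b" using sref_strict_mono 2 by blast
      then show ?thesis using 2 by (simp add: inversions_def sref_def)
    qed (use lt in \<open>simp add: inversions_def\<close>)
  qed
  moreover have "(k, Suc k) \<notin> (\<lambda>(a, b). (?s a, ?s b)) ` inversions u"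
  proof (clarify)
    fix a b assume *: "(a, b) \<in> inversions u" and "k = ?s a" "Suc k = ?s b"
    then have "a = Suc k" "b = k" by (metis sref_simps transpose_eq_iff sref_def)+
    then show False using * by (auto simp: inversions_def)
  qed
  moreover have "inj_on (\<lambda>(a, b). (?s a, ?s b)) (inversions u)"
    by (auto simp: inj_on_def sref_def transpose_eq_transpose_iff)
  ultimately show ?thesis
    using finite_inversions[OF u] by (simp add: inv_num_def card_image)
qed

lemma wprod_append: "wprod (xs @ ys) = wprod xs \<circ> wprod ys"
  by (induction xs) (auto simp: wprod_def fun_eq_iff)

lemma wprod_simps [simp]: "wprod [] = id" "wprod [k] = sref k"
  by (auto simp: wprod_def)

lemma wprod_Sn: "set ws \<subseteq> {..<n-1} \<Longrightarrow> wprod ws \<in> Sn n"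
proof (induction ws rule: rev_induct)
  case (snoc k ws)
  then have "sref k \<in> Sn n" by (intro Sn_sref) auto
  then show ?case using snoc unfolding wprod_append wprod_simps by (intro Sn_comp) auto
qed (simp add: Sn_id)

lemma inv_num_wprod: "set ws \<subseteq> {..<n-1} \<Longrightarrow> inv_num (wprod ws) \<le> length ws"
proof (induction ws rule: rev_induct)
  case Nil
  then show ?case unfolding wprod_simps inv_num_id by simp
next
  case (snoc k ws)
  let ?u = "wprod ws"
  have u: "?u \<in> Sn n" "sref k \<in> Sn n" using snoc.prems by (auto intro!: wprod_Sn Sn_sref)
  have "inv_num (?u \<circ> sref k) \<le> Suc (inv_num ?u)"
  proof (cases "?u k < ?u (Suc k)")
    case True
    then show ?thesis using inv_num_sref[OF u(1)] by simp
  next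
    case False
    then have "(?u \<circ> sref k) k < (?u \<circ> sref k) (Suc k)"
      using Sn_inj[OF u(1), of k "Suc k"] by auto
    then show ?thesis using inv_num_sref[OF Sn_comp[OF u], of k] by simp
  qed
  moreover have "inv_num ?u \<le> length ws" using snoc by simp
  ultimately show ?case
    unfolding wprod_append wprod_simps length_append by (simp only: list.size)
qed

text \<open>Used through its contrapositive: a permutation other than the identity has a right
  descent, which the inductions on the number of inversions remove.\<close>

lemma ascending_imp_id:
  assumes u: "u \<in> Sn n" and asc: "\<And>k. Suc k < n \<Longrightarrow> u k < u (Suc k)"
  shows "u = id"
proof (rule permutes_natset_ge)
  show "u permutes {..<n}" using u by (simp add: Sn_def)
  have "i < n \<Longrightarrow> i \<le> u i" for i
  proof (induction i)
    case (Suc i)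
    then show ?case using asc[of i] by fastforce
  qed simp
  then show "\<forall>i\<in>{..<n}. i \<le> u i" by simp
qed

text \<open>Sorting by adjacent swaps: each removed descent lowers the number of inversions by
  exactly one and contributes one letter at the end of the word.\<close>

lemma ex_word: "u \<in> Sn n \<Longrightarrow> \<exists>ws. length ws = inv_num u \<and> set ws \<subseteq> {..<n-1} \<and> wprod ws = u"
proof (induction "inv_num u" arbitrary: u rule: less_induct)
  case less
  show ?case
  proof (cases "u = id")
    case True
    then show ?thesis by (intro exI[of _ "[]"]) simp
  next
    case False
    then obtain k where k: "Suc k < n" "\<not> u k < u (Suc k)" using ascending_imp_id[OF less.prems] by blast
    let ?w = "u \<circ> sref k"
    have w: "?w \<in> Sn n" using k Sn_comp Sn_sref less.prems by blast
    have "?w k < ?w (Suc k)" using k Sn_inj[OF less.prems, of k "Suc k"] by auto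
    then have inv: "inv_num u = Suc (inv_num ?w)" using inv_num_sref[OF w, of k] by simp
    then obtain ws where "length ws = inv_num ?w" "set ws \<subseteq> {..<n-1}" "wprod ws = ?w"
      using less.hyps[OF _ w] by auto
    then show ?thesis using k inv
      by (intro exI[of _ "ws @ [k]"]) (auto simp: wprod_append)
  qed
qed

lemma blength_eq: "u \<in> Sn n \<Longrightarrow> blength n u = inv_num u"
  unfolding blength_def
  by (rule Least_equality) (use ex_word inv_num_wprod in auto)

section \<open>Bruhat order and the lifting property\<close>

lemma bstep_iff: "bstep n u w \<longleftrightarrow> u \<in> Sn n \<and> (\<exists>i j. i < j \<and> j < n \<and> w = u \<circ> transpose i j \<and> u i < u j)"
proof -
  have "blength n u < blength n (u \<circ> transpose i j) \<longleftrightarrow> u i < u j" if u: "u \<in> Sn n" and ij: "i < j" "j < n" for i j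
  proof -
    have w: "u \<circ> transpose i j \<in> Sn n" using that Sn_comp Sn_transpose by simp
    have "(u \<circ> transpose i j) \<circ> transpose i j = u" by (simp add: fun_eq_iff)
    then have "inv_num (u \<circ> transpose i j) < inv_num u" if "u j < u i"
      using inv_num_transpose[OF w ij] that by simp
    moreover have "u i \<noteq> u j" using Sn_inj[OF u, of i j] ij by simp
    ultimately show ?thesis
      using inv_num_transpose[OF u ij] unfolding blength_eq[OF u] blength_eq[OF w] by (metis less_asym linorder_neqE_nat)
  qed
  then show ?thesis unfolding bstep_def by blast
qed

lemma bstep_Sn: "bstep n u w \<Longrightarrow> u \<in> Sn n \<and> w \<in> Sn n"
  unfolding bstep_iff using Sn_comp Sn_transpose by auto

lemma bruhat_refl: "u \<in> Sn n \<Longrightarrow> bruhat_le n u u"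
  by (simp add: bruhat_le_def)

lemma bruhat_step: "bstep n u w \<Longrightarrow> bruhat_le n u w"
  by (auto simp: bruhat_le_def bstep_Sn)

lemma bruhat_trans: "bruhat_le n u w \<Longrightarrow> bruhat_le n w x \<Longrightarrow> bruhat_le n u x"
  by (auto simp: bruhat_le_def)

lemma bruhat_induct [consumes 1, case_names refl step]:
  assumes "bruhat_le n u w" "u \<in> Sn n \<Longrightarrow> Q u"
    "\<And>x y. bruhat_le n u x \<Longrightarrow> bstep n x y \<Longrightarrow> Q x \<Longrightarrow> Q y"
  shows "Q w"
proof -
  have "(bstep n)\<^sup>*\<^sup>* u w" "u \<in> Sn n" using assms(1) by (auto simp: bruhat_le_def)
  then show ?thesis
    by (induction rule: rtranclp_induct) (use assms(2,3) in \<open>auto simp: bruhat_le_def\<close>)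
qed

lemma bruhat_Sn: "bruhat_le n u w \<Longrightarrow> u \<in> Sn n \<and> w \<in> Sn n"
  by (induction rule: bruhat_induct) (auto dest: bstep_Sn)

lemma bruhat_inv_num: "bruhat_le n u w \<Longrightarrow> u = w \<or> inv_num u < inv_num w"
proof (induction rule: bruhat_induct)
  case (step x y)
  then have "inv_num x < inv_num y" by (auto simp: bstep_iff inv_num_transpose)
  then show ?case using step by auto
qed simp

lemma bruhat_antisym: "bruhat_le n u w \<Longrightarrow> bruhat_le n w u \<Longrightarrow> u = w"
  by (metis bruhat_inv_num less_asym)

lemma bruhat_sref: 
  assumes "u \<in> Sn n" "Suc k < n" "u k < u (Suc k)" shows "bruhat_le n u (u \<circ> sref k)"
  by (rule bruhat_step) (use assms in \<open>auto simp: bstep_iff sref_def\<close>)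

lemma bruhat_sref_desc:
  assumes "u \<in> Sn n" "Suc k < n" "\<not> u k < u (Suc k)" shows "bruhat_le n (u \<circ> sref k) u"
proof -
  have "u \<circ> sref k \<in> Sn n" using assms Sn_comp Sn_sref by blast
  then show ?thesis
    using bruhat_sref[of "u \<circ> sref k" n k] assms Sn_inj[OF assms(1), of k "Suc k"] by auto
qed

text \<open>Conjugation by \<open>sref k\<close> sends the swap of \<open>i\<close> and
  \<open>j\<close> to the swap of their images, which stay in order unless the swap is
  \<open>sref k\<close> itself.\<close>

lemma bstep_sref:
  assumes "bstep n u w" "Suc k < n"
  shows "w = u \<circ> sref k \<or> bstep n (u \<circ> sref k) (w \<circ> sref k)"
proof -
  obtain i j where u: "u \<in> Sn n" and ij: "i < j" "j < n" "w = u \<circ> transpose i j" "u i < u j"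
    using assms(1) unfolding bstep_iff by blast
  show ?thesis
  proof (cases "(i, j) = (k, Suc k)")
    case True
    then show ?thesis using ij by (simp add: sref_def)
  next
    case False
    let ?s = "sref k"
    have "?s i < ?s j" using sref_strict_mono[OF ij(1) False] .
    moreover have "?s j < n" using Sn_lt[OF Sn_sref[OF assms(2)]] ij by blast
    moreover have "w \<circ> ?s = (u \<circ> ?s) \<circ> transpose (?s i) (?s j)"
      using transpose_comp_eq[of ?s i j] unfolding ij(3) sref_def
      by (auto simp: fun_eq_iff transpose_def)
    moreover have "u (?s (?s i)) < u (?s (?s j))" using ij by (simp add: sref_def)
    ultimately show ?thesis unfolding bstep_iff using Sn_comp[OF u Sn_sref[OF assms(2)]] by auto
  qed
qed

text \<open>\<open>lo k u\<close> and \<open>hi k u\<close> are the smaller and the larger element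
  of the pair \<open>u\<close>, \<open>u \<circ> sref k\<close>; they state the lifting property
  without case distinctions.\<close>

definition lo :: "nat \<Rightarrow> perm \<Rightarrow> perm" where
  "lo k u = (if u k < u (Suc k) then u else u \<circ> sref k)"

definition hi :: "nat \<Rightarrow> perm \<Rightarrow> perm" where
  "hi k u = (if u k < u (Suc k) then u \<circ> sref k else u)"

text \<open>A Bruhat step either stays inside one pair or induces a step between the partners. In
  the second case both \<open>x \<le> y\<close> and the comparison of partners are available, and
  comparisons within the pairs supply the rest.\<close>

lemma lo_hi_mono:
  assumes "bruhat_le n u w" and k: "Suc k < n"
  shows "bruhat_le n (lo k u) (lo k w) \<and> bruhat_le n (hi k u) (hi k w)"
  using assms(1)
proof (induction rule: bruhat_induct)
  case refl
  then show ?case using Sn_comp[OF refl Sn_sref[OF k]] by (simp add: lo_def hi_def bruhat_refl)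
next
  case (step x y)
  have Sn: "x \<in> Sn n" "y \<in> Sn n" using step bstep_Sn by blast+
  have xs: "x \<circ> sref k \<in> Sn n" using Sn_comp[OF Sn(1) Sn_sref[OF k]] .
  note up = bruhat_sref[OF Sn(1) k] bruhat_sref[OF Sn(2) k]
  note down = bruhat_sref_desc[OF Sn(1) k] bruhat_sref_desc[OF Sn(2) k]
  have "bruhat_le n (lo k x) (lo k y) \<and> bruhat_le n (hi k x) (hi k y)"
    using bstep_sref[OF step(2) k]
  proof
    assume y: "y = x \<circ> sref k"
    have "x k \<noteq> x (Suc k)" using Sn_inj[OF Sn(1)] by simp
    then show ?thesis using Sn xs by (auto simp: lo_def hi_def y bruhat_refl)
  next
    assume "bstep n (x \<circ> sref k) (y \<circ> sref k)"
    then have 1: "bruhat_le n (x \<circ> sref k) (y \<circ> sref k)" by (rule bruhat_step)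
    have 2: "bruhat_le n x y" using step(2) by (rule bruhat_step)
    show ?thesis
    proof (cases "x k < x (Suc k)"; cases "y k < y (Suc k)")
      assume "x k < x (Suc k)" "\<not> y k < y (Suc k)"
      then show ?thesis
        using bruhat_trans[OF up(1) 1] bruhat_trans[OF 1 down(2)] by (simp add: lo_def hi_def)
    next
      assume "\<not> x k < x (Suc k)" "y k < y (Suc k)"
      then show ?thesis
        using bruhat_trans[OF down(1) 2] bruhat_trans[OF 2 up(2)] by (simp add: lo_def hi_def)
    qed (simp_all add: lo_def hi_def 1 2)
  qed
  then show ?case using step.IH bruhat_trans by blast
qed

lemma bruhat_lift_lo:
  assumes "bruhat_le n u w" "Suc k < n" "u k < u (Suc k)" "\<not> w k < w (Suc k)"
  shows "bruhat_le n u (w \<circ> sref k)"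
  using lo_hi_mono[OF assms(1,2)] assms(3,4) by (simp add: lo_def)

lemma bruhat_lift_hi:
  assumes "bruhat_le n u w" "Suc k < n" "\<not> w k < w (Suc k)"
  shows "bruhat_le n (u \<circ> sref k) w"
proof (cases "u k < u (Suc k)")
  case True
  then show ?thesis using lo_hi_mono[OF assms(1,2)] assms(3) by (simp add: hi_def)
next
  case False
  then show ?thesis using bruhat_sref_desc assms bruhat_Sn bruhat_trans by blast
qed

lemma bruhat_id: "u \<in> Sn n \<Longrightarrow> bruhat_le n id u"
proof (induction "inv_num u" arbitrary: u rule: less_induct)
  case less
  show ?case
  proof (cases "u = id")
    case True
    then show ?thesis using Sn_id bruhat_refl by simp
  next
    case False
    then obtain k where k: "Suc k < n" "\<not> u k < u (Suc k)" using ascending_imp_id[OF less.prems] by blast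
    let ?w = "u \<circ> sref k"
    have w: "?w \<in> Sn n" using k Sn_comp Sn_sref less.prems by blast
    have "?w k < ?w (Suc k)" using k Sn_inj[OF less.prems, of k "Suc k"] by auto
    then have "inv_num ?w < inv_num u" using inv_num_sref[OF w, of k] by simp
    then show ?thesis using less.hyps[OF _ w] bruhat_sref_desc[OF less.prems k] bruhat_trans by blast
  qed
qed

text \<open>Preserving the initial segments \<open>{..k}\<close> for \<open>k \<notin> J\<close> characterises the parabolic subgroup of \<open>J\<close>.\<close>

definition cuts :: "nat \<Rightarrow> nat set \<Rightarrow> perm set" where
  "cuts n J = {u \<in> Sn n. \<forall>k. k \<notin> J \<longrightarrow> (\<forall>a. u a \<le> k \<longleftrightarrow> a \<le> k)}"

section \<open>Parabolic subgroups and their longest elements\<close>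

lemma cutsD: "u \<in> cuts n J \<Longrightarrow> k \<notin> J \<Longrightarrow> u a \<le> k \<longleftrightarrow> a \<le> k"
  by (simp add: cuts_def)

lemma cuts_Sn: "u \<in> cuts n J \<Longrightarrow> u \<in> Sn n"
  by (simp add: cuts_def)

lemma cuts_id: "id \<in> cuts n J"
  by (simp add: cuts_def Sn_id)

lemma sref_le: "k \<noteq> j \<Longrightarrow> sref j a \<le> k \<longleftrightarrow> a \<le> k"
  by (auto simp: sref_def transpose_def)

lemma cuts_sref: "u \<in> cuts n J \<Longrightarrow> j \<in> J \<Longrightarrow> Suc j < n \<Longrightarrow> u \<circ> sref j \<in> cuts n J"
  unfolding cuts_def using Sn_comp[OF _ Sn_sref, of u n j] by auto (metis sref_le)+

lemma parab_cuts:
  assumes "J \<subseteq> {..<n-1}" shows "parab J \<subseteq> cuts n J"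
proof -
  have "set ws \<subseteq> J \<Longrightarrow> wprod ws \<in> cuts n J" for ws
  proof (induction ws rule: rev_induct)
    case (snoc j ws)
    then have "wprod ws \<in> cuts n J" "j \<in> J" "Suc j < n" using assms by auto
    then show ?case unfolding wprod_append wprod_simps by (rule cuts_sref)
  qed (simp add: cuts_id)
  then show ?thesis by (auto simp: parab_def)
qed

lemma parab_max_descents:
  assumes J: "J \<subseteq> {..<n-1}" "v \<in> parab J" and max: "\<And>u. u \<in> parab J \<Longrightarrow> blength n u \<le> blength n v"
    and k: "k \<in> J"
  shows "\<not> v k < v (Suc k)"
proof
  assume lt: "v k < v (Suc k)"
  have v: "v \<in> cuts n J" using parab_cuts J by blast
  obtain ws where ws: "set ws \<subseteq> J" "v = wprod ws" using J(2) by (auto simp: parab_def)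
  have "wprod (ws @ [k]) \<in> parab J" using ws k unfolding parab_def by force
  then have p: "v \<circ> sref k \<in> parab J" using ws by (simp add: wprod_append)
  then have "v \<circ> sref k \<in> cuts n J" using parab_cuts J(1) by blast
  then show False using max[OF p] inv_num_sref[OF cuts_Sn[OF v] lt] v
    by (simp add: blength_eq cuts_Sn)
qed

lemma longest_parabolicD:
  assumes "longest_parabolic n v"
  obtains J where "J \<subseteq> {..<n-1}" "v \<in> cuts n J" "\<And>k. k \<in> J \<Longrightarrow> \<not> v k < v (Suc k)"
proof -
  obtain J where J: "J \<subseteq> {..<n-1}" "v \<in> parab J" "\<And>u. u \<in> parab J \<Longrightarrow> blength n u \<le> blength n v"
    using assms unfolding longest_parabolic_def by blast
  show ?thesis by (rule that[OF J(1)]) (use parab_max_descents[OF J] parab_cuts J in auto)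
qed

lemma antimono_between:
  assumes "\<And>k. b \<le> k \<Longrightarrow> k < c \<Longrightarrow> \<not> x k < x (Suc k)" "x \<in> Sn n" "b < c"
  shows "x c < x b"
proof -
  have "x c < x b" if "b < c" "\<forall>k. b \<le> k \<and> k < c \<longrightarrow> \<not> x k < x (Suc k)" for c
    using that
  proof (induction c)
    case (Suc c)
    have "x (Suc c) < x c" using Suc.prems Sn_inj[OF assms(2), of c "Suc c"] by (metis less_Suc_eq_le lessI linorder_neqE_nat n_not_Suc_n)
    then show ?case using Suc by (cases "b = c") auto
  qed simp
  then show ?thesis using assms by blast
qed

text \<open>It suffices that \<open>x \<circ> inv y\<close> ascends at every \<open>a\<close>. For
  \<open>a\<close> outside \<open>J\<close> the cut at \<open>a\<close> separates the two values.
  For \<open>a\<close> in \<open>J\<close> the preimages of \<open>a\<close> and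
  \<open>Suc a\<close> under \<open>y\<close> lie in one block, on which \<open>x\<close> and
  \<open>y\<close> both decrease.\<close>

lemma cuts_desc_unique:
  assumes x: "x \<in> cuts n J" "\<And>k. k \<in> J \<Longrightarrow> \<not> x k < x (Suc k)"
    and y: "y \<in> cuts n J" "\<And>k. k \<in> J \<Longrightarrow> \<not> y k < y (Suc k)"
  shows "x = y"
proof -
  have xy: "x \<in> Sn n" "y \<in> Sn n" using x y cuts_Sn by auto
  let ?i = "inv y" and ?z = "x \<circ> inv y"
  have i: "y (?i a) = a" for a using Sn_bij[OF xy(2)] by (simp add: bij_is_surj surj_f_inv_f)
  have iSn: "?i \<in> Sn n" using xy(2) by (simp add: Sn_def permutes_inv)
  have z: "?z \<in> Sn n" using Sn_comp[OF xy(1) iSn] .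
  have "?z = id"
  proof (rule ascending_imp_id[OF z])
    fix a
    let ?b = "?i a" and ?c = "?i (Suc a)"
    have ne: "?b \<noteq> ?c" using i by (metis n_not_Suc_n)
    show "?z a < ?z (Suc a)"
    proof (cases "a \<in> J")
      case False
      have "?b \<le> a" "\<not> ?c \<le> a" using cutsD[OF y(1) False] i by (metis le_refl, metis not_less_eq_eq le_refl)
      then have "x ?b \<le> a" "\<not> x ?c \<le> a" using cutsD[OF x(1) False] by auto
      then show ?thesis by simp
    next
      case True
      \<comment> \<open>A cut \<open>k\<close> between the two preimages would also separate the
        values \<open>a\<close> and \<open>Suc a\<close>, forcing \<open>k = a\<close>.\<close>
      have inJ: "k \<in> J" if "min ?b ?c \<le> k" "k < max ?b ?c" for k
      proof (rule ccontr)
        assume k: "k \<notin> J"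
        have "k \<noteq> a" using True k by auto
        have "?b \<le> k \<longleftrightarrow> a \<le> k" "?c \<le> k \<longleftrightarrow> Suc a \<le> k" using cutsD[OF y(1) k, of ?b] cutsD[OF y(1) k, of ?c] i by auto
        then show False using that \<open>k \<noteq> a\<close> by (auto simp: min_def max_def split: if_splits)
      qed
      show ?thesis
      proof (cases "?b < ?c")
        case True
        then have "y ?c < y ?b" using antimono_between[OF _ xy(2) True] y(2) inJ by simp
        then show ?thesis using i by simp
      next
        case False
        then have "?c < ?b" using ne by simp
        then have "x ?b < x ?c" using antimono_between[OF _ xy(1) \<open>?c < ?b\<close>] x(2) inJ by simp
        then show ?thesis by simp
      qed
    qed
  qed
  then have "x (?i (y a)) = y a" for a by (simp add: fun_eq_iff)
  then show ?thesis using Sn_bij[OF xy(2)] by (simp add: fun_eq_iff bij_is_inj)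
qed

text \<open>Positions \<open>i \<le> k < j\<close> on two sides of a cut cannot be swapped in a step
  up to \<open>y\<close>: the cut in \<open>y\<close> would give \<open>x j \<le> k < x i\<close>,
  against \<open>x i < x j\<close>.\<close>

lemma cuts_down:
  assumes "bruhat_le n u w" "w \<in> cuts n J" shows "u \<in> cuts n J"
proof -
  have step: "x \<in> cuts n J" if b: "bstep n x y" and y: "y \<in> cuts n J" for x y
  proof -
    obtain i j where xy: "x \<in> Sn n" "i < j" "y = x \<circ> transpose i j" "x i < x j"
      using b unfolding bstep_iff by blast
    have "x a \<le> k \<longleftrightarrow> a \<le> k" if k: "k \<notin> J" for a k
      using cutsD[OF y k, of i] cutsD[OF y k, of j]
        cutsD[OF y k, of a] xy by (cases "a = i"; cases "a = j") auto
    then show ?thesis using xy by (simp add: cuts_def)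
  qed
  have "w \<in> cuts n J \<longrightarrow> u \<in> cuts n J"
    using assms(1) by (induction rule: bruhat_induct) (use step in auto)
  then show ?thesis using assms(2) by blast
qed

lemma cuts_up:
  assumes v: "v \<in> cuts n J" "\<And>k. k \<in> J \<Longrightarrow> \<not> v k < v (Suc k)" and J: "J \<subseteq> {..<n-1}"
    and q: "q \<in> cuts n J" "q \<noteq> v"
  obtains k where "k \<in> J" "Suc k < n" "q k < q (Suc k)" "q \<circ> sref k \<in> cuts n J"
proof -
  obtain k where k: "k \<in> J" "q k < q (Suc k)" using cuts_desc_unique[OF v(1,2) q(1)] q(2) by blast
  then have "Suc k < n" using J by auto
  then show ?thesis using that k cuts_sref[OF q(1)] by blast
qed

text \<open>Starting from \<open>q\<close>, ascents in \<open>J\<close> are multiplied on until the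
  unique element without such ascents is reached; \<open>n * n\<close> bounds the number of
  inversions and gives termination.\<close>

lemma cuts_le_top:
  assumes v: "v \<in> cuts n J" "\<And>k. k \<in> J \<Longrightarrow> \<not> v k < v (Suc k)" and J: "J \<subseteq> {..<n-1}"
  shows "q \<in> cuts n J \<Longrightarrow> bruhat_le n q v"
proof (induction "n * n - inv_num q" arbitrary: q rule: less_induct)
  case less
  show ?case
  proof (cases "q = v")
    case True
    then show ?thesis using cuts_Sn[OF v(1)] bruhat_refl by simp
  next
    case False
    then obtain k where k: "k \<in> J" "Suc k < n" "q k < q (Suc k)" "q \<circ> sref k \<in> cuts n J"
      using cuts_up[OF v J less.prems] by blast
    have qs: "q \<circ> sref k \<in> Sn n" using k(4) cuts_Sn by blast
    have "inv_num (q \<circ> sref k) \<le> card ({..<n} \<times> {..<n})"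
      unfolding inv_num_def by (rule card_mono[OF _ inversions_sub[OF qs]]) simp
    then have "n * n - inv_num (q \<circ> sref k) < n * n - inv_num q"
      using inv_num_sref[OF cuts_Sn[OF less.prems] k(3)] by simp
    then have "bruhat_le n (q \<circ> sref k) v" using less.hyps k(4) by blast
    then show ?thesis using bruhat_sref[OF cuts_Sn[OF less.prems] k(2,3)] bruhat_trans by blast
  qed
qed

text \<open>By the lifting property a right descent \<open>k \<notin> J\<close> of \<open>p\<close> may be dropped without changing
  the part of \<open>[id, p]\<close> inside the parabolic subgroup.\<close>

lemma cuts_dichotomy:
  assumes "J \<subseteq> {..<n-1}"
  shows "p \<in> Sn n \<Longrightarrow> (\<forall>q\<in>cuts n J. bruhat_le n q p \<longrightarrow> q = id) \<or>
    (\<exists>k\<in>J. \<forall>q\<in>cuts n J. bruhat_le n q p \<longrightarrow> bruhat_le n (q \<circ> sref k) p)"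
proof (induction "inv_num p" arbitrary: p rule: less_induct)
  case less
  show ?case
  proof (cases "p = id")
    case True
    then have "q = id" if "bruhat_le n q p" for q
      using bruhat_inv_num[OF that] unfolding True inv_num_id by blast
    then show ?thesis by blast
  next
    case False
    then obtain k where k: "Suc k < n" "\<not> p k < p (Suc k)" using ascending_imp_id[OF less.prems] by blast
    show ?thesis
    proof (cases "k \<in> J")
      case True
      then show ?thesis using bruhat_lift_hi k by blast
    next
      case nJ: False
      let ?w = "p \<circ> sref k"
      have w: "?w \<in> Sn n" using k Sn_comp Sn_sref less.prems by blast
      have "?w k < ?w (Suc k)" using k Sn_inj[OF less.prems, of k "Suc k"] by auto
      then have "inv_num ?w < inv_num p" using inv_num_sref[OF w, of k] by simp
      note IH = less.hyps[OF this w]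
      have "bruhat_le n q p \<longleftrightarrow> bruhat_le n q ?w" if q: "q \<in> cuts n J" for q
      proof
        \<comment> \<open>The cut at \<open>k\<close> makes \<open>k\<close> an ascent of
          \<open>q\<close>, so the lifting property pushes \<open>q\<close> below
          \<open>p \<circ> sref k\<close>.\<close>
        have "q k \<le> k" "\<not> q (Suc k) \<le> k" using cutsD[OF q nJ] by auto
        then have "q k < q (Suc k)" by simp
        then show "bruhat_le n q ?w" if "bruhat_le n q p" using bruhat_lift_lo[OF that k(1)] k by blast
        show "bruhat_le n q p" if "bruhat_le n q ?w" using that bruhat_sref_desc[OF less.prems k] bruhat_trans by blast
      qed
      moreover have "q \<circ> sref j \<in> cuts n J" if "q \<in> cuts n J" "j \<in> J" for q j
        by (rule cuts_sref[OF that]) (use that assms in auto)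
      ultimately show ?thesis using IH by metis
    qed
  qed
qed

section \<open>Robinson-Schensted shapes\<close>

text \<open>What insertion of a decreasing run larger than all earlier entries produces: one new
  cell at the end of each of the first rows, the smallest entry on top.\<close>

fun addcol :: "nat list list \<Rightarrow> nat list \<Rightarrow> nat list list" where
  "addcol T [] = T"
| "addcol [] (x # xs) = [x] # addcol [] xs"
| "addcol (r # T) (x # xs) = (r @ [x]) # addcol T xs"

fun inc :: "nat \<Rightarrow> nat list \<Rightarrow> nat list" where
  "inc 0 l = l"
| "inc (Suc c) [] = 1 # inc c []"
| "inc (Suc c) (a # l) = Suc a # inc c l"

text \<open>For \<open>k = 0\<close> this is the partition statistic usually written
  \<open>n(\<lambda>)\<close>, which gives the values of the a-function.\<close>

fun wt :: "nat \<Rightarrow> nat list \<Rightarrow> nat" where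
  "wt k [] = 0"
| "wt k (a # l) = k * a + wt (Suc k) l"

text \<open>One-line notation of the longest element of a Young subgroup with block sizes
  \<open>cs\<close>, using the values from \<open>l\<close> on.\<close>

fun block_word :: "nat \<Rightarrow> nat list \<Rightarrow> nat list" where
  "block_word l [] = []"
| "block_word l (c # cs) = rev [l..<l + c] @ block_word (l + c) cs"

text \<open>The new \<open>x\<close> is larger than the old row and smaller than the cell last
  appended to it, so it bumps exactly that cell, which meets the same situation one row
  below.\<close>

lemma rowins_addcol:
  "sorted_wrt (<) (x # xs) \<Longrightarrow> \<forall>r\<in>set T. \<forall>z\<in>set r. z < x \<Longrightarrow> rowins x (addcol T xs) = addcol T (x # xs)"
proof (induction T xs arbitrary: x rule: addcol.induct)
  case (1 T)
  show ?case
  proof (cases T)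
    case (Cons r rs)
    then have "filter (\<lambda>y. x < y) r = []" using 1 by (auto simp: filter_empty_conv)
    then show ?thesis using Cons by simp
  qed simp
next
  case (3 r T y ys)
  then have "\<forall>z\<in>set r. z < x" by simp
  then have "filter (\<lambda>z. x < z) r = []" "map (\<lambda>z. if z = y then x else z) r = r"
    using 3 by (auto simp: filter_empty_conv intro!: map_idI)
  moreover have "rowins y (addcol T ys) = addcol T (y # ys)"
    by (rule 3) (use 3 in fastforce)+
  ultimately show ?case using 3 by simp
qed simp

lemma foldl_rowins_rev:
  "sorted_wrt (<) xs \<Longrightarrow> \<forall>r\<in>set T. \<forall>z\<in>set r. \<forall>x\<in>set xs. z < x \<Longrightarrow>
    foldl (\<lambda>T x. rowins x T) T (rev xs) = addcol T xs"
  by (induction xs) (simp_all add: rowins_addcol)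

lemma set_addcol: "\<Union> (set ` set (addcol T xs)) = \<Union> (set ` set T) \<union> set xs"
  by (induction T xs rule: addcol.induct) auto

lemma shape_addcol: "map length (addcol T xs) = inc (length xs) (map length T)"
  by (induction T xs rule: addcol.induct) auto

lemma shape_block_word:
  "\<forall>r\<in>set T. \<forall>z\<in>set r. z < l \<Longrightarrow> map length (foldl (\<lambda>T x. rowins x T) T (block_word l cs))
    = foldl (\<lambda>s c. inc c s) (map length T) cs"
proof (induction cs arbitrary: l T)
  case (Cons c cs)
  have "foldl (\<lambda>T x. rowins x T) T (rev [l..<l + c]) = addcol T [l..<l + c]"
    by (rule foldl_rowins_rev) (use Cons.prems in \<open>fastforce simp: sorted_wrt_upt\<close>)+
  moreover have "\<forall>r\<in>set (addcol T [l..<l + c]). \<forall>z\<in>set r. z < l + c"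
  proof (intro ballI)
    fix r z assume "r \<in> set (addcol T [l..<l + c])" "z \<in> set r"
    then have "z \<in> \<Union> (set ` set T) \<union> set [l..<l + c]" unfolding set_addcol[symmetric] by blast
    then show "z < l + c" using Cons.prems by force
  qed
  ultimately show ?case using Cons.IH[of "addcol T [l..<l + c]" "l + c"] by (simp add: shape_addcol)
qed simp

lemma wt_inc: "wt k (inc c l) = wt k l + (\<Sum>i<c. k + i)"
  by (induction c l arbitrary: k rule: inc.induct) (simp_all add: sum.lessThan_Suc_shift sum_Suc)

lemma wt_foldl_inc: "wt 0 (foldl (\<lambda>s c. inc c s) s cs) = wt 0 s + (\<Sum>c\<leftarrow>cs. \<Sum>i<c. i)"
  by (induction cs arbitrary: s) (simp_all add: wt_inc)

lemma sum_inc: "sum_list (inc c l) = c + sum_list l"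
  by (induction c l rule: inc.induct) auto

section \<open>Inversions and one-line words of longest parabolic elements\<close>

fun list_inv :: "nat list \<Rightarrow> nat" where
  "list_inv [] = 0"
| "list_inv (x # xs) = length (filter (\<lambda>y. y < x) xs) + list_inv xs"

lemma list_inv_append: "\<forall>x\<in>set xs. \<forall>y\<in>set ys. x < y \<Longrightarrow> list_inv (xs @ ys) = list_inv xs + list_inv ys"
proof (induction xs)
  case (Cons x xs)
  then have "filter (\<lambda>y. y < x) ys = []" by (force simp: filter_empty_conv)
  then show ?case using Cons by simp
qed simp

lemma list_inv_rev_upt: "list_inv (rev [l..<l + c]) = (\<Sum>i<c. i)"
proof (induction c)
  case (Suc c)
  have "filter (\<lambda>y. y < l + c) (rev [l..<l + c]) = rev [l..<l + c]"
    by (rule filter_True) simp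
  then show ?case using Suc by simp
qed simp

lemma set_block_word: "set (block_word l cs) = {l..<l + sum_list cs}"
  by (induction cs arbitrary: l) auto

lemma length_block_word [simp]: "length (block_word l cs) = sum_list cs"
  by (induction cs arbitrary: l) auto

lemma distinct_block_word: "distinct (block_word l cs)"
  by (induction cs arbitrary: l) (auto simp: set_block_word)

lemma list_inv_block_word: "list_inv (block_word l cs) = (\<Sum>c\<leftarrow>cs. \<Sum>i<c. i)"
proof (induction cs arbitrary: l)
  case (Cons c cs)
  have "list_inv (block_word l (c # cs)) = list_inv (rev [l..<l + c]) + list_inv (block_word (l + c) cs)"
    unfolding block_word.simps by (rule list_inv_append) (auto simp: set_block_word)
  then show ?case using Cons by (simp add: list_inv_rev_upt)
qed simp

lemma card_inversions_from:
  "l \<le> n \<Longrightarrow> card {(a, b). l \<le> a \<and> a < b \<and> b < n \<and> u b < u a} = list_inv (map u [l..<n])"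
proof (induction "n - l" arbitrary: l)
  case 0
  then have "{(a, b). l \<le> a \<and> a < b \<and> b < n \<and> u b < u a} = {}" by auto
  with 0 show ?case by (simp only: card.empty) simp
next
  case (Suc d)
  let ?X = "\<lambda>l. {(a, b). l \<le> a \<and> a < b \<and> b < n \<and> u b < u a}"
  let ?B = "{b \<in> {Suc l..<n}. u b < u l}"
  have fin: "finite (?X (Suc l))" by (rule finite_subset[of _ "{..<n} \<times> {..<n}"]) auto
  have "?X l = Pair l ` ?B \<union> ?X (Suc l)"
    by (auto simp: image_iff Suc_le_eq)
  moreover have "card (Pair l ` ?B) = card ?B" by (rule card_image) (simp add: inj_on_def)
  moreover have "card (Pair l ` ?B \<union> ?X (Suc l)) = card (Pair l ` ?B) + card (?X (Suc l))"
    by (rule card_Un_disjoint) (use fin in auto)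
  moreover have "card (?X (Suc l)) = list_inv (map u [Suc l..<n])"
    by (rule Suc.hyps) (use Suc in auto)
  moreover have "card ?B = length (filter (\<lambda>y. y < u l) (map u [Suc l..<n]))"
  proof -
    have "?B = set (filter (\<lambda>b. u b < u l) [Suc l..<n])" by auto
    also have "card \<dots> = length (filter (\<lambda>b. u b < u l) [Suc l..<n])"
      by (rule distinct_card) simp
    finally show ?thesis by (simp add: filter_map o_def)
  qed
  moreover have "[l..<n] = l # [Suc l..<n]" using Suc by (simp add: upt_rec)
  ultimately show ?case by simp
qed

lemma inv_num_list_inv: "u \<in> Sn n \<Longrightarrow> inv_num u = list_inv (map u [0..<n])"
proof -
  assume u: "u \<in> Sn n"
  then have "inversions u = {(a, b). 0 \<le> a \<and> a < b \<and> b < n \<and> u b < u a}"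
    using inversions_sub[OF u] by (auto simp: inversions_def)
  then show ?thesis unfolding inv_num_def using card_inversions_from[of 0 n u] by simp
qed

text \<open>The first block ends at the least \<open>r \<ge> l\<close> outside \<open>J\<close>. The
  cuts on both sides make \<open>v\<close> map this segment to itself, and the descents inside make
  it the reversal.\<close>

lemma block_word_of_cuts:
  assumes v: "v \<in> cuts n J" "\<And>k. k \<in> J \<Longrightarrow> \<not> v k < v (Suc k)" and J: "J \<subseteq> {..<n-1}"
  shows "l \<le> n \<Longrightarrow> l = 0 \<or> l - 1 \<notin> J \<Longrightarrow> \<exists>cs. map v [l..<n] = block_word l cs"
proof (induction "n - l" arbitrary: l rule: less_induct)
  case less
  have vSn: "v \<in> Sn n" using v(1) by (rule cuts_Sn)
  show ?case
  proof (cases "l = n")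
    case True
    then show ?thesis by (intro exI[of _ "[]"]) simp
  next
    case False
    define r where "r = (LEAST r. l \<le> r \<and> r \<notin> J)"
    \<comment> \<open>The last position \<open>n - 1\<close> is never in \<open>J\<close>, so the
      least cut exists and the block stays below \<open>n\<close>.\<close>
    have n1: "l \<le> n - 1 \<and> n - 1 \<notin> J" using False less.prems J by auto
    have r: "l \<le> r" "r \<notin> J" using LeastI[of "\<lambda>r. l \<le> r \<and> r \<notin> J", OF n1] by (auto simp: r_def)
    have "r \<le> n - 1" unfolding r_def by (rule Least_le) (rule n1)
    then have rn: "Suc r \<le> n" using False less.prems by simp
    have inJ: "k \<in> J" if "l \<le> k" "k < r" for k
      using not_less_Least[of k "\<lambda>r. l \<le> r \<and> r \<notin> J"] that by (auto simp: r_def)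
    have dec: "v c < v b" if "l \<le> b" "b < c" "c \<le> r" for b c
      by (rule antimono_between[OF _ vSn]) (use that v(2) inJ in auto)
    have "rev (map v [l..<Suc r]) = [l..<Suc r]"
    proof (rule sorted_distinct_set_unique)
      have "sorted_wrt (\<lambda>x y. v y \<le> v x) [l..<Suc r]"
        by (rule sorted_wrt_mono_rel[OF _ sorted_wrt_upt]) (use dec in \<open>auto simp: less_imp_le less_Suc_eq_le\<close>)
      then show "sorted (rev (map v [l..<Suc r]))" by (simp add: sorted_wrt_rev sorted_wrt_map del: upt_Suc)
      have inj: "inj_on v {l..<Suc r}" using Sn_inj[OF vSn] by (simp add: inj_on_def)
      then show "distinct (rev (map v [l..<Suc r]))" by (simp add: distinct_map del: upt_Suc)
      have "v a \<in> {l..<Suc r}" if "a \<in> {l..<Suc r}" for a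
        using cutsD[OF v(1) r(2), of a] cutsD[OF v(1), of "l - 1" a] less.prems(2) that by auto
      then have "v ` {l..<Suc r} = {l..<Suc r}"
        using inj by (intro card_subset_eq) (auto simp: card_image)
      then show "set (rev (map v [l..<Suc r])) = set [l..<Suc r]" by (simp del: upt_Suc)
    qed (simp_all del: upt_Suc)
    then have seg: "map v [l..<Suc r] = rev [l..<Suc r]" by (metis rev_rev_ident)
    have "n - Suc r < n - l" using rn r by linarith
    then obtain cs where cs: "map v [Suc r..<n] = block_word (Suc r) cs"
      using less.hyps[of "Suc r"] rn r by auto
    have "[l..<n] = [l..<Suc r] @ [Suc r..<n]" using upt_add_eq_append[of l "Suc r" "n - Suc r"] r rn by simp
    then have "map v [l..<n] = block_word l ((Suc r - l) # cs)"
      using seg cs r by (simp del: upt_Suc)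
    then show ?thesis by blast
  qed
qed

lemma longest_parabolic_block_word:
  assumes "longest_parabolic n v"
  obtains cs where "map v [0..<n] = block_word 0 cs" "v \<in> Sn n"
  using longest_parabolicD[OF assms] block_word_of_cuts[of v n _ 0] cuts_Sn by (metis le0)

text \<open>A block of size \<open>c\<close> contributes \<open>0 + ... + (c - 1)\<close> to both
  sides: its inversions on the left, the row numbers of its new cells on the right.\<close>

lemma blength_wt_shape:
  assumes "longest_parabolic n v"
  shows "blength n v = wt 0 (rs_shape n v)"
proof -
  obtain cs where cs: "map v [0..<n] = block_word 0 cs" "v \<in> Sn n"
    using longest_parabolic_block_word[OF assms] .
  have "rs_shape n v = foldl (\<lambda>s c. inc c s) [] cs"
    using shape_block_word[of "[]" 0 cs] unfolding rs_shape_def rs_P_def cs by simp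
  then show ?thesis
    using cs by (simp add: blength_eq inv_num_list_inv list_inv_block_word wt_foldl_inc)
qed

text \<open>Ascents occur only at the end of a block, and there the initial segment of positions is
  mapped to the initial segment of values.\<close>

lemma block_word_ascent:
  "Suc k < sum_list cs \<Longrightarrow> block_word l cs ! k < block_word l cs ! Suc k \<Longrightarrow> a < sum_list cs \<Longrightarrow>
    block_word l cs ! a \<le> l + k \<longleftrightarrow> a \<le> k"
proof (induction cs arbitrary: l k a)
  case (Cons c cs)
  let ?B = "block_word (l + c) cs"
  have R: "block_word l (c # cs) ! i = l + c - Suc i" if "i < c" for i
    using that by (simp add: nth_append rev_nth)
  have B: "block_word l (c # cs) ! i = ?B ! (i - c)" if "\<not> i < c" for i
    using that by (simp add: nth_append)
  have Bge: "l + c \<le> ?B ! i" if "i < sum_list cs" for i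
    using nth_mem[of i ?B] that by (simp add: set_block_word)
  consider "Suc k < c" | "Suc k = c" | "c \<le> k" by linarith
  then show ?case
  proof cases
    case 1
    then show ?thesis using Cons.prems(2) R[of k] R[of "Suc k"] by simp
  next
    case 2
    show ?thesis
    proof (cases "a < c")
      case True
      then show ?thesis using R 2 by auto
    next
      case False
      then have "l + c \<le> block_word l (c # cs) ! a" using Bge[of "a - c"] B Cons.prems(3) by auto
      then show ?thesis using 2 False by linarith
    qed
  next
    case 3
    show ?thesis
    proof (cases "a < c")
      case True
      then show ?thesis using R 3 by auto
    next
      case False
      have "?B ! (a - c) \<le> l + c + (k - c) \<longleftrightarrow> a - c \<le> k - c"
        by (rule Cons.IH) (use Cons.prems 3 False B[of k] B[of "Suc k"] in \<open>auto simp: Suc_diff_le\<close>)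
      then show ?thesis using B[of a] 3 False by auto
    qed
  qed
qed simp

text \<open>\<open>J\<close> is taken to be the descent set of the permutation \<open>y\<close> with
  the given block word. Both \<open>y\<close> and a longest element of the subgroup respect the cuts
  of \<open>J\<close> and descend on \<open>J\<close>, so they coincide by uniqueness.\<close>

lemma ex_longest_parabolic:
  assumes n: "sum_list cs = n"
  obtains v where "longest_parabolic n v" "rs_shape n v = foldl (\<lambda>s c. inc c s) [] cs"
proof -
  let ?w = "block_word 0 cs"
  define y where "y = (\<lambda>i. if i < n then ?w ! i else i)"
  have "bij_betw ((!) ?w) {..<n} {..<n}"
    by (rule bij_betw_nth[OF distinct_block_word]) (auto simp: n set_block_word)
  then have "bij_betw y {..<n} {..<n}"
    by (rule bij_betw_cong[THEN iffD1, rotated]) (simp add: y_def)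
  then have y: "y \<in> Sn n" unfolding Sn_def by (auto intro!: bij_imp_permutes simp: y_def split: if_splits)
  define J where "J = {k. Suc k < n \<and> y (Suc k) < y k}"
  have J: "J \<subseteq> {..<n-1}" by (auto simp: J_def)
  have cuts: "y a \<le> k \<longleftrightarrow> a \<le> k" if k: "k \<notin> J" for a k
  proof (cases "a < n \<and> Suc k < n")
    case True
    then have "y k < y (Suc k)" using k Sn_inj[OF y, of k "Suc k"] by (simp add: J_def)
    then show ?thesis using True block_word_ascent[of k cs 0 a] n by (simp add: y_def)
  next
    case False
    then show ?thesis using Sn_lt[OF y, of a] Sn_ge[OF y, of a] by (cases "a < n") auto
  qed
  have yc: "y \<in> cuts n J" using y cuts by (simp add: cuts_def)
  have fin: "finite (parab J)"
    by (rule finite_subset[OF _ finite_Sn[of n]]) (use parab_cuts[OF J] cuts_Sn in blast)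
  have "wprod [] \<in> parab J" unfolding parab_def by (rule CollectI, rule exI[of _ "[]"]) simp
  then have "Max (blength n ` parab J) \<in> blength n ` parab J"
    using fin by (intro Max_in) auto
  then obtain v where v: "v \<in> parab J" "blength n v = Max (blength n ` parab J)" by auto
  have max: "blength n u \<le> blength n v" if "u \<in> parab J" for u
    unfolding v(2) by (rule Max_ge) (use fin that in auto)
  have "v = y"
  proof (rule cuts_desc_unique)
    show "v \<in> cuts n J" using parab_cuts[OF J] v by blast
    show "\<not> v k < v (Suc k)" if "k \<in> J" for k using parab_max_descents[OF J v(1) max that] .
  qed (use yc in \<open>auto simp: J_def\<close>)
  then have "map v [0..<n] = ?w" by (intro nth_equalityI) (auto simp: y_def n)
  then have "rs_shape n v = foldl (\<lambda>s c. inc c s) [] cs"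
    using shape_block_word[of "[]" 0 cs] unfolding rs_shape_def rs_P_def by simp
  moreover have "longest_parabolic n v" unfolding longest_parabolic_def using J v(1) max by blast
  ultimately show ?thesis using that by blast
qed

text \<open>Lowering all parts by one removes the first column. The parts that become zero are at
  the end, and \<open>inc\<close> restores them as ones.\<close>

lemma inc_remove_column:
  "sorted_wrt (\<ge>) l \<Longrightarrow> \<forall>x\<in>set l. 0 < x \<Longrightarrow>
    inc (length l) (filter (\<lambda>x. 0 < x) (map (\<lambda>x. x - 1) l)) = l"
proof (induction l)
  case (Cons a l)
  show ?case
  proof (cases "a = 1")
    case True
    then have "filter (\<lambda>x. 0 < x) (map (\<lambda>x. x - 1) l) = []" using Cons.prems by (auto simp: filter_empty_conv)
    then show ?thesis using Cons True by simp
  next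
    case False
    then show ?thesis using Cons by (cases a) auto
  qed
qed simp

text \<open>The first column is removed recursively and put back last, so \<open>cs\<close> lists
  the column lengths from right to left.\<close>

lemma ex_columns:
  "sorted_wrt (\<ge>) l \<Longrightarrow> \<forall>x\<in>set l. 0 < x \<Longrightarrow>
    \<exists>cs. foldl (\<lambda>s c. inc c s) [] cs = l \<and> sum_list cs = sum_list l"
proof (induction "sum_list l" arbitrary: l rule: less_induct)
  case less
  show ?case
  proof (cases "l = []")
    case True
    then show ?thesis by (intro exI[of _ "[]"]) simp
  next
    case False
    let ?l = "filter (\<lambda>x. 0 < x) (map (\<lambda>x. x - 1) l)"
    note eq = inc_remove_column[OF less.prems]
    have sum: "sum_list l = length l + sum_list ?l" using sum_inc[of "length l" ?l] unfolding eq .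
    have "sorted_wrt (\<ge>) (map (\<lambda>x. x - 1) l)"
      unfolding sorted_wrt_map by (rule sorted_wrt_mono_rel[OF _ less.prems(1)]) auto
    then have sorted: "sorted_wrt (\<ge>) ?l" by (rule sorted_wrt_filter)
    have "0 < length l" using False by simp
    then have "sum_list ?l < sum_list l" using sum by linarith
    from less.hyps[OF this sorted]
    obtain cs where cs: "foldl (\<lambda>s c. inc c s) [] cs = ?l" "sum_list cs = sum_list ?l" by auto
    have "foldl (\<lambda>s c. inc c s) [] (cs @ [length l]) = l" by (simp only: foldl_append foldl.simps cs(1) eq)
    moreover have "sum_list (cs @ [length l]) = sum_list l" using cs(2) sum by simp
    ultimately show ?thesis by blast
  qed
qed

section \<open>Row insertion and partition shapes\<close>

definition above :: "nat list \<Rightarrow> nat list \<Rightarrow> bool" where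
  "above r s \<longleftrightarrow> length s \<le> length r \<and> (\<forall>i<length s. r ! i < s ! i)"

text \<open>Standard tableaux with arbitrary distinct entries: the invariant of row insertion that
  makes every shape a partition.\<close>

definition tableau :: "nat list list \<Rightarrow> bool" where
  "tableau T \<longleftrightarrow> (\<forall>r\<in>set T. r \<noteq> [] \<and> sorted_wrt (<) r) \<and> successively above T \<and> distinct (concat T)"

definition row_result :: "nat \<Rightarrow> nat list \<Rightarrow> nat list" where
  "row_result x r = (case filter (\<lambda>y. x < y) r of [] \<Rightarrow> r @ [x] | y # _ \<Rightarrow> map (\<lambda>z. if z = y then x else z) r)"

text \<open>Either \<open>x\<close> is appended, or it bumps the entry at the first index
  \<open>k\<close> with a larger value. Strict increase makes that entry unique, so the replacement
  is a list update.\<close>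

lemma row_cases:
  assumes "sorted_wrt (<) r" "x \<notin> set r"
  obtains "filter (\<lambda>y. x < y) r = []" "\<forall>z\<in>set r. z < x" "row_result x r = r @ [x]"
  | k ys where "k < length r" "filter (\<lambda>y. x < y) r = r ! k # ys" "x < r ! k" "\<forall>j<k. r ! j < x"
      "row_result x r = r[k := x]" "map (\<lambda>z. if z = r ! k then x else z) r = r[k := x]"
proof (cases "filter (\<lambda>y. x < y) r")
  case Nil
  then have "\<forall>z\<in>set r. \<not> x < z" by (simp add: filter_empty_conv)
  then have "\<forall>z\<in>set r. z < x" using assms(2) by (metis linorder_neqE_nat)
  then show ?thesis using that(1) Nil by (simp add: row_result_def)
next
  case (Cons y ys)
  from filter_eq_ConsD[OF this]
  obtain us vs where r: "r = us @ y # vs" "\<forall>u\<in>set us. \<not> x < u" "x < y" by auto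
  have us: "u < x" if "u \<in> set us" for u
    using r assms(2) that by (metis UnCI linorder_neqE_nat set_append)
  have ne: "z \<noteq> y" if "z \<in> set us \<union> set vs" for z
    using assms(1) that unfolding r by (auto simp: sorted_wrt_append)
  have m: "map (\<lambda>z. if z = y then x else z) r = r[length us := x]"
    unfolding r using ne by (auto simp: list_update_append intro!: map_idI)
  have k: "r ! length us = y" by (simp add: r)
  show ?thesis
  proof (rule that(2)[of "length us" ys])
    show "\<forall>j<length us. r ! j < x" using us by (simp add: r nth_append)
  qed (use r m k Cons in \<open>simp_all add: row_result_def\<close>)
qed

lemma row_result_props:
  assumes "sorted_wrt (<) r" "x \<notin> set r"
  shows "sorted_wrt (<) (row_result x r)" "row_result x r \<noteq> []"
  using assms
proof (atomize (full), cases rule: row_cases[OF assms])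
  case 1
  then show "sorted_wrt (<) (row_result x r) \<and> row_result x r \<noteq> []"
    using assms by (simp add: sorted_wrt_append)
next
  case (2 k ys)
  have "r[k := x] ! i < r[k := x] ! j" if "i < j" "j < length r" for i j
  proof -
    have s: "r ! i < r ! j" using assms(1) that by (simp add: sorted_wrt_iff_nth_less)
    consider "i = k" | "j = k" | "i \<noteq> k" "j \<noteq> k" by blast
    then show ?thesis using s 2(1,3,4) that by cases auto
  qed
  then show "sorted_wrt (<) (row_result x r) \<and> row_result x r \<noteq> []"
    using 2 by (auto simp: sorted_wrt_iff_nth_less)
qed

text \<open>The bumped entry moves weakly to the left: it lands in the next row at an index at most
  \<open>k\<close>, below an entry that is smaller than itself.\<close>

lemma above_bump:
  assumes r: "sorted_wrt (<) r" "k < length r" "x < r ! k" and s: "sorted_wrt (<) s" "r ! k \<notin> set s"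
    and rs: "above r s"
  shows "above (r[k := x]) (row_result (r ! k) s)"
  using s
proof (cases rule: row_cases[OF s])
  case 1
  have "\<not> k < length s"
    using 1(2) rs unfolding above_def by (metis less_asym nth_mem)
  then show ?thesis
    using 1(3) rs r unfolding above_def
    by (auto simp: nth_append nth_list_update less_Suc_eq sorted_wrt_iff_nth_less)
next
  case (2 m ys)
  \<comment> \<open>For \<open>k < m\<close> the entry \<open>s ! k\<close> would be below
    \<open>r ! k\<close>, although \<open>r\<close> stands above \<open>s\<close>.\<close>
  have mk: "m \<le> k"
  proof (rule ccontr)
    assume "\<not> m \<le> k"
    then have "s ! k < r ! k" "k < length s" using 2 by auto
    then show False using rs unfolding above_def by (metis less_asym)
  qed
  have "r[k := x] ! i < s[m := r ! k] ! i" if i: "i < length s" for i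
  proof (cases "i = m")
    case True
    then show ?thesis using mk r that by (auto simp: nth_list_update sorted_wrt_iff_nth_less)
  next
    case False
    then have "r ! i < s ! i" using rs i unfolding above_def by simp
    then show ?thesis using False r by (auto simp: nth_list_update)
  qed
  then show ?thesis using 2(5) rs unfolding above_def by simp
qed

lemma rowins_hd: "\<exists>rs. rowins x (r # T) = row_result x r # rs"
  by (auto simp: row_result_def split: list.split)

lemma above_append: "above r s \<Longrightarrow> above (r @ [x]) s"
  by (auto simp: above_def nth_append)

lemma tableau_rowins:
  "tableau T \<Longrightarrow> x \<notin> set (concat T) \<Longrightarrow> tableau (rowins x T) \<and> set (concat (rowins x T)) = insert x (set (concat T))"
proof (induction T arbitrary: x)
  case Nil
  then show ?case by (simp add: tableau_def)
next
  case (Cons r T)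
  have r: "sorted_wrt (<) r" "x \<notin> set r" and T: "tableau T" and d: "distinct r" "set r \<inter> set (concat T) = {}"
    using Cons.prems by (auto simp: tableau_def successively_Cons)
  show ?case
  proof (cases rule: row_cases[OF r])
    case 1
    then have "rowins x (r # T) = (r @ [x]) # T" by simp
    moreover have "successively above ((r @ [x]) # T)"
      using Cons.prems(1) above_append by (auto simp: tableau_def successively_Cons)
    ultimately show ?thesis
      using Cons.prems 1 by (auto simp: tableau_def sorted_wrt_append)
  next
    case (2 k ys)
    let ?y = "r ! k"
    have eq: "rowins x (r # T) = r[k := x] # rowins ?y T" using 2 by simp
    have y: "?y \<in> set r" "?y \<notin> set (concat T)" using nth_mem[OF 2(1)] d(2) by blast+
    note IH = Cons.IH[OF T y(2)]
    have set: "set (r[k := x]) = insert x (set r - {?y})"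
      using set_update_distinct[OF d(1) 2(1)] .
    have "above (r[k := x]) (hd (rowins ?y T)) \<and> rowins ?y T \<noteq> []"
    proof (cases T)
      case Nil
      then show ?thesis using 2 r by (cases k) (auto simp: above_def Suc_le_eq sorted_wrt_iff_nth_less)
    next
      case (Cons s T')
      then have "above r s" "sorted_wrt (<) s" "?y \<notin> set s"
        using Cons.prems y by (auto simp: tableau_def)
      then show ?thesis using above_bump[OF r(1) 2(1,3)] rowins_hd[of ?y s T'] Cons by auto
    qed
    then have succ: "successively above (r[k := x] # rowins ?y T)"
      using IH by (auto simp: tableau_def successively_Cons)
    have r': "sorted_wrt (<) (r[k := x])" "r[k := x] \<noteq> []" using row_result_props[OF r] 2(5) by auto
    have R: "\<forall>s\<in>set (rowins ?y T). s \<noteq> [] \<and> sorted_wrt (<) s" "distinct (concat (rowins ?y T))"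
        "set (concat (rowins ?y T)) = insert ?y (set (concat T))"
      using IH by (simp_all add: tableau_def)
    have "x \<notin> set (concat T)" "x \<noteq> ?y" using Cons.prems(2) r(2) y(1) by auto
    then have "set (r[k := x]) \<inter> set (concat (rowins ?y T)) = {}"
      unfolding set R(3) using d(2) by blast
    moreover have "distinct (r[k := x])" using d(1) r(2) by (simp add: distinct_list_update)
    ultimately have "distinct (concat (r[k := x] # rowins ?y T))"
      unfolding concat.simps distinct_append using R(2) by blast
    then have "tableau (rowins x (r # T))"
      unfolding eq tableau_def using succ r' R(1) by simp
    moreover have "set (concat (rowins x (r # T))) = insert x (set (concat (r # T)))"
      unfolding eq concat.simps set_append set R(3) using y(1) by blast
    ultimately show ?thesis ..
  qed
qed

lemma tableau_foldl:
  "distinct xs \<Longrightarrow> tableau T \<Longrightarrow> set xs \<inter> set (concat T) = {} \<Longrightarrow> tableau (foldl (\<lambda>T x. rowins x T) T xs)"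
proof (induction xs arbitrary: T)
  case (Cons x xs)
  have "tableau (rowins x T)" "set (concat (rowins x T)) = insert x (set (concat T))"
    using tableau_rowins[OF Cons.prems(2)] Cons.prems(3) by auto
  then show ?case using Cons by auto
qed simp

lemma sum_rowins: "sum_list (map length (rowins x T)) = Suc (sum_list (map length T))"
  by (induction x T rule: rowins.induct) (auto split: list.split)

lemma sum_foldl_rowins: "sum_list (map length (foldl (\<lambda>T x. rowins x T) T xs)) = sum_list (map length T) + length xs"
  by (induction xs arbitrary: T) (simp_all add: sum_rowins)

lemma rs_shape_partition:
  assumes "w \<in> Sn n"
  shows "sorted_wrt (\<ge>) (rs_shape n w)" "\<forall>x\<in>set (rs_shape n w). 0 < x" "sum_list (rs_shape n w) = n"
proof -
  have t: "tableau (rs_P n w)"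
    unfolding rs_P_def
    by (rule tableau_foldl) (use Sn_inj[OF assms] in \<open>auto simp: tableau_def distinct_map inj_on_def\<close>)
  have "successively (\<ge>) (rs_shape n w)"
    unfolding rs_shape_def successively_map
    by (rule successively_mono[of above]) (use t in \<open>auto simp: tableau_def above_def\<close>)
  then show "sorted_wrt (\<ge>) (rs_shape n w)"
    by (simp add: successively_conv_sorted_wrt transp_on_def)
  show "\<forall>x\<in>set (rs_shape n w). 0 < x"
    using t by (auto simp: rs_shape_def tableau_def)
  show "sum_list (rs_shape n w) = n"
    by (simp add: rs_shape_def rs_P_def sum_foldl_rowins)
qed

text \<open>The statistic \<open>wt 0\<close> of the shape satisfies the defining conditions. It is
  the only such function because every shape is a partition and is realised by a longest parabolic
  element, where the value is prescribed.\<close>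

lemma a_fun_longest:
  assumes v: "longest_parabolic n v"
  shows "a_fun n v = blength n v"
proof -
  define a where "a = (\<lambda>w. if w \<in> Sn n then wt 0 (rs_shape n w) else 0)"
  have Sn: "w \<in> Sn n" if "longest_parabolic n w" for w
    using longest_parabolic_block_word[OF that] by blast
  have "a_fun n = a"
    unfolding a_fun_def
  proof (rule the_equality)
    show "(\<forall>w. w \<notin> Sn n \<longrightarrow> a w = 0)
      \<and> (\<forall>u \<in> Sn n. \<forall>w \<in> Sn n. rs_shape n u = rs_shape n w \<longrightarrow> a u = a w)
      \<and> (\<forall>w. longest_parabolic n w \<longrightarrow> a w = blength n w)"
      using blength_wt_shape Sn by (simp add: a_def)
  next
    fix b assume b: "(\<forall>w. w \<notin> Sn n \<longrightarrow> b w = 0)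
      \<and> (\<forall>u \<in> Sn n. \<forall>w \<in> Sn n. rs_shape n u = rs_shape n w \<longrightarrow> b u = b w)
      \<and> (\<forall>w. longest_parabolic n w \<longrightarrow> b w = blength n w)"
    show "b = a"
    proof
      fix w
      show "b w = a w"
      proof (cases "w \<in> Sn n")
        case True
        \<comment> \<open>Reading off the columns of the shape gives the block sizes of a longest
          parabolic element in the same class as \<open>w\<close>.\<close>
        obtain cs where "foldl (\<lambda>s c. inc c s) [] cs = rs_shape n w" "sum_list cs = n"
          using ex_columns[OF rs_shape_partition(1,2)[OF True]] rs_shape_partition(3)[OF True] by auto
        then obtain u where u: "longest_parabolic n u" "rs_shape n u = rs_shape n w"
          using ex_longest_parabolic[of cs n] by metis
        have "b w = b u" using b True Sn[OF u(1)] u(2) by metis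
        also have "\<dots> = wt 0 (rs_shape n u)" using b u(1) blength_wt_shape by metis
        finally show ?thesis using True u(2) by (simp add: a_def)
      qed (use b in \<open>simp add: a_def\<close>)
    qed
  qed
  then show ?thesis using blength_wt_shape[OF v] Sn[OF v] by (simp add: a_def)
qed

section \<open>The grade of a simple module\<close>

lemma sref_comp_neq: "u \<in> Sn n \<Longrightarrow> u \<circ> sref k \<noteq> u"
  using Sn_inj[of u n k "Suc k"] by (metis comp_apply n_not_Suc_n sref_simps(1))

lemma bruhat_sref_iff:
  assumes "u \<in> Sn n" "Suc k < n"
  shows "bruhat_le n u (u \<circ> sref k) \<longleftrightarrow> u k < u (Suc k)"
    and "bruhat_le n (u \<circ> sref k) u \<longleftrightarrow> \<not> u k < u (Suc k)"
  using bruhat_sref[OF assms] bruhat_sref_desc[OF assms] bruhat_antisym sref_comp_neq[OF assms(1)] by metis+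

lemma grade_simpleL:
  assumes v: "longest_parabolic n v"
  shows "grade (incA n :: ('k::field, perm \<Rightarrow> perm \<Rightarrow> 'k) kalg) (simpleL v) = enat (blength n v)"
proof -
  obtain J where J: "J \<subseteq> {..<n-1}" and vJ: "v \<in> cuts n J" "\<And>k. k \<in> J \<Longrightarrow> \<not> v k < v (Suc k)"
    using longest_parabolicD[OF v] by blast
  have vSn: "v \<in> Sn n" using vJ(1) by (rule cuts_Sn)
  interpret simple_ext "Sn n" "bruhat_le n" v "TYPE('k)"
    by unfold_locales (use finite_Sn bruhat_Sn bruhat_refl bruhat_trans bruhat_antisym vSn in blast)+
  have Alg: "Alg = (incA n :: ('k, perm \<Rightarrow> perm \<Rightarrow> 'k) kalg)" by (simp add: Alg_def incA_def)
  have L: "L = (simpleL v :: ('k, perm \<Rightarrow> perm \<Rightarrow> 'k, 'k) kamod)" by (simp add: L_def simpleL_def)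
  \<comment> \<open>Downward closure and maximality of \<open>v\<close> identify the interval below
    \<open>v\<close> with \<open>cuts n J\<close>.\<close>
  have below: "bruhat_le n q v \<longleftrightarrow> q \<in> cuts n J" for q
    using cuts_down[OF _ vJ(1)] cuts_le_top[OF vJ J] by blast
  have lift: "lifting (\<lambda>x. x \<circ> sref k)" if k: "Suc k < n" for k
    unfolding lifting_def
  proof (intro conjI ballI allI impI; (elim conjE)?)
    fix x assume x: "x \<in> Sn n"
    show "x \<circ> sref k \<in> Sn n" by (rule Sn_comp[OF x Sn_sref[OF k]])
    show "bruhat_le n x (x \<circ> sref k) \<or> bruhat_le n (x \<circ> sref k) x" using bruhat_sref_iff[OF x k] by blast
  next
    fix x y assume *: "bruhat_le n x y" "bruhat_le n x (x \<circ> sref k)" "bruhat_le n (y \<circ> sref k) y"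
    then have "x \<in> Sn n" "y \<in> Sn n" using bruhat_Sn by blast+
    then show "bruhat_le n x (y \<circ> sref k)" using * bruhat_lift_lo k bruhat_sref_iff by blast
  qed simp
  have Jn: "Suc k < n" if "k \<in> J" for k using that J by auto
  \<comment> \<open>Every \<open>k\<close> in \<open>J\<close> is a descent of \<open>v\<close>, so
    \<open>v\<close> is always the upper element of its pair.\<close>
  have top: "x \<noteq> v" if "k \<in> J" "bruhat_le n x (x \<circ> sref k)" for k x
    using that vJ(2) bruhat_sref_iff(1)[OF vSn Jn] by blast
  have id: "inv_num v - inv_num id = inv_num v" unfolding inv_num_id by simp
  have single: "(\<forall>i < inv_num v. vanish {(p, id)} i) \<and> \<not> vanish {(p, id)} (inv_num v)" for p
  proof -
    have "(\<forall>i < inv_num v - inv_num id. vanish {(p, id)} i) \<and> \<not> vanish {(p, id)} (inv_num v - inv_num id)"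
    proof (rule vanish_below_top[where len = inv_num])
      show "bruhat_le n id v" by (rule bruhat_id[OF vSn])
      show "inv_num q \<le> inv_num v" if "bruhat_le n q v" for q using bruhat_inv_num[OF that] by auto
      fix q assume q: "bruhat_le n q v" "q \<noteq> v"
      then have qJ: "q \<in> cuts n J" using below by blast
      obtain k where k: "k \<in> J" "Suc k < n" "q k < q (Suc k)" "q \<circ> sref k \<in> cuts n J"
        using cuts_up[OF vJ J qJ q(2)] by blast
      show "\<exists>\<tau>. lifting \<tau> \<and> bruhat_le n q (\<tau> q) \<and> inv_num (\<tau> q) = Suc (inv_num q)
        \<and> bruhat_le n (\<tau> q) v \<and> (\<forall>x. bruhat_le n x (\<tau> x) \<longrightarrow> x \<noteq> v)"
        using lift[OF k(2)] bruhat_sref[OF cuts_Sn[OF qJ] k(2,3)] inv_num_sref[OF cuts_Sn[OF qJ] k(3)]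
          k(4) below top[OF k(1)]
        by (intro exI[of _ "\<lambda>x. x \<circ> sref k"]) blast
    qed
    then show ?thesis unfolding id .
  qed
  have "(\<forall>i<inv_num v. vanish {(p, q). bruhat_le n q p} i) \<and> \<not> vanish {(p, q). bruhat_le n q p} (inv_num v)"
  proof (rule vanish_regular[where e = id])
    show "bruhat_le n id p" if "p \<in> Sn n" for p by (rule bruhat_id[OF that])
    show "\<forall>p. vanish {(p, id)} i" if "i < inv_num v" for i using single that by blast
    show "\<not> vanish {(id, id)} (inv_num v)" using single by blast
    fix p assume "p \<in> Sn n"
    from cuts_dichotomy[OF J this]
    show "(\<forall>q. bruhat_le n q p \<and> bruhat_le n q v \<longrightarrow> q = id) \<or>
      (\<exists>\<tau>. lifting \<tau> \<and> (\<forall>x. bruhat_le n x (\<tau> x) \<longrightarrow> x \<noteq> v) \<and>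
        (\<forall>q. bruhat_le n q p \<and> bruhat_le n q v \<longrightarrow> bruhat_le n (\<tau> q) p \<and> bruhat_le n (\<tau> q) v))"
    proof
      assume "\<exists>k\<in>J. \<forall>q\<in>cuts n J. bruhat_le n q p \<longrightarrow> bruhat_le n (q \<circ> sref k) p"
      then obtain k where k: "k \<in> J" "\<And>q. q \<in> cuts n J \<Longrightarrow> bruhat_le n q p \<Longrightarrow> bruhat_le n (q \<circ> sref k) p"
        by blast
      \<comment> \<open>The involution of the dichotomy is right multiplication by this
        \<open>sref k\<close>: it preserves the elements below \<open>p\<close> by the choice of
        \<open>k\<close>, and those below \<open>v\<close> because \<open>k\<close> is in
        \<open>J\<close>.\<close>
      show ?thesis
        using lift[OF Jn[OF k(1)]] top[OF k(1)] k(2) cuts_sref[OF _ k(1) Jn[OF k(1)]] below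
        by (intro disjI2 exI[of _ "\<lambda>x. x \<circ> sref k"]) blast
    qed (use below in blast)
  qed
  then have ext: "\<forall>i<inv_num v. \<not> ext_nonzero (incA n :: ('k, perm \<Rightarrow> perm \<Rightarrow> 'k) kalg) (simpleL v) (regular (incA n)) i"
    "ext_nonzero (incA n :: ('k, perm \<Rightarrow> perm \<Rightarrow> 'k) kalg) (simpleL v) (regular (incA n)) (inv_num v)"
    using ext_nonzero_regular unfolding Alg L by blast+
  then have "(LEAST i. ext_nonzero (incA n :: ('k, perm \<Rightarrow> perm \<Rightarrow> 'k) kalg) (simpleL v) (regular (incA n)) i) = inv_num v"
    by (intro Least_equality) (auto simp: not_less[symmetric])
  then show ?thesis
    using ext(2) unfolding grade_def blength_eq[OF vSn] by auto
qed

theorem theorem7p1: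
  fixes n :: nat and v :: perm
  assumes alg_closed: "\<forall>p :: 'k::field_char_0 poly. degree p > 0 \<longrightarrow> (\<exists>x. poly p x = 0)"
    and "longest_parabolic n v"
  shows "grade (incA n :: ('k, perm \<Rightarrow> perm \<Rightarrow> 'k) kalg) (simpleL v) = enat (a_fun n v)
         \<and> a_fun n v = blength n v"
  using grade_simpleL[OF assms(2)] a_fun_longest[OF assms(2)] by simp

end
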